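(* Let $G$ be a finite group, let $n\ge 0$ be an integer, and let $0\to A\xrightarrow{\iota}B\xrightarrow{\pi}C\to0$ be a short exact sequence of $G$-modules admitting a symmetric section compatible with the actions, i.e. a set map $s_\pi:C\to B$ with $\pi\circ s_\pi=\mathrm{id}_C$, $s_\pi(-c)=-s_\pi(c)$ and $s_\pi(gc)=g\,s_\pi(c)$ for all $c\in C$, $g\in G$. Then there is a connecting homomorphism in symmetric cohomology $$\beta_G^{n,S}:\mathrm{HS}^n(G,C)\to\mathrm{HS}^{n+1}(G,A)$$ given by $\beta_G^{n,S}([\varphi]):=[\beta_G^n(\varphi)]$, where $\beta_G^n(\varphi)=r_\iota\circ\partial_B^n(s_\pi\circ\varphi)$, for any $\varphi\in\ker\partial_C^n\cap CS^n(G,C)$.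
   Context: For a $G$-module $A$, $C^n(G,A)=\mathrm{Maps}(G^{n},A)$ ($C^0=A$) with the standard differential $\partial_A^n(\varphi)(g_1,\dots,g_{n+1})=g_1\varphi(g_2,\dots,g_{n+1})+\sum_{j=1}^n(-1)^j\varphi(g_1,\dots,g_jg_{j+1},\dots,g_{n+1})+(-1)^{n+1}\varphi(g_1,\dots,g_n)$ (the subscript records the coefficient module). The symmetric group $\Sigma_{n+1}$ acts on $C^n(G,A)$ (Staic) through the transpositions $\sigma_i=(i,i+1)$, $1\le i\le n$: $(\sigma_1\varphi)(g_1,\dots,g_n)=-g_1\varphi(g_1^{-1},g_1g_2,g_3,\dots,g_n)$ (for $n=1$: $-g_1\varphi(g_1^{-1})$); $(\sigma_i\varphi)(g_1,\dots,g_n)=-\varphi(g_1,\dots,g_{i-1}g_i,g_i^{-1},g_ig_{i+1},\dots,g_n)$ for $1<i<n$; $(\sigma_n\varphi)(g_1,\dots,g_n)=-\varphi(g_1,\dots,g_{n-1}g_n,g_n^{-1})$ for $n\ge2$. The invariants $CS^n(G,A)=C^n(G,A)^{\Sigma_{n+1}}$ form a subcomplex of $C^*(G,A)$, whose cohomology is the symmetric cohomology $\mathrm{HS}^n(G,A)$. $r_\iota:\ker\pi\to A$ is the inverse of the isomorphism $A\to\ker\pi$, $a\mapsto\iota(a)$. (For $\varphi\in\ker\partial_C^n$, $\partial_B^n(s_\pi\circ\varphi)$ takes values in $\ker\pi$ and $r_\iota\circ\partial_B^n(s_\pi\circ\varphi)\in\ker\partial_A^{n+1}$.) "Connecting homomorphism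 in symmetric cohomology" means that the formula gives a well-defined group homomorphism, and that it is the connecting homomorphism of the long exact sequence in symmetric cohomology associated with the given short exact sequence (via the complexes $CS^*(G,A)$, $CS^*(G,B)$, $CS^*(G,C)$). *)

theory Defs
  imports "HOL-Algebra.FiniteProduct" "HOL-Algebra.Group_Action" "HOL-Algebra.Product_Groups"
begin

text \<open>
  The abelian groups underlying \<open>G\<close>-modules are \<open>comm_group\<close>s, hence written multiplicatively:
  \<open>\<otimes>\<close>, \<open>inv\<close>, \<open>\<one>\<close> and \<open>[^]\<close> stand for the usual \<open>+\<close>, \<open>-\<close>, \<open>0\<close> and integer multiples.
\<close>

locale G_module = group_action G "carrier M" act + M: comm_group M
  for G (structure) and M (structure) and act +
  assumes act_hom: "g \<in> carrier G \<Longrightarrow> act g \<in> hom M M"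

definition equivariant ::
    "('g, 'x) monoid_scheme \<Rightarrow> ('a, 'y) monoid_scheme \<Rightarrow> ('g \<Rightarrow> 'a \<Rightarrow> 'a) \<Rightarrow> ('g \<Rightarrow> 'b \<Rightarrow> 'b) \<Rightarrow>
     ('a \<Rightarrow> 'b) \<Rightarrow> bool" where
  "equivariant G M actM actN f \<longleftrightarrow>
     (\<forall>g \<in> carrier G. \<forall>x \<in> carrier M. f (actM g x) = actN g (f x))"

text \<open>
  The library's \<open>short_exact_sequence\<close> forces all groups to live on one type; this is its
  characterisation \<open>short_exact_sequence_iff\<close> for groups on different types.
\<close>
definition short_exact ::
    "('a, 'x) monoid_scheme \<Rightarrow> ('b, 'y) monoid_scheme \<Rightarrow> ('c, 'z) monoid_scheme \<Rightarrow>
     ('a \<Rightarrow> 'b) \<Rightarrow> ('b \<Rightarrow> 'c) \<Rightarrow> bool" where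
  "short_exact X Y Z f g \<longleftrightarrow> f \<in> mon X Y \<and> g \<in> epi Y Z \<and> kernel Y Z g = f ` carrier X"


section \<open>Inhomogeneous cochains\<close>

definition tuples :: "('g, 'x) monoid_scheme \<Rightarrow> nat \<Rightarrow> 'g list set" where
  "tuples G n = {gs. length gs = n \<and> set gs \<subseteq> carrier G}"

text \<open>
  \<open>C\<^sup>n(G,M)\<close> with pointwise operations; \<open>C\<^sup>0(G,M)\<close> is \<open>M\<close> in the guise of functions on the empty tuple.
\<close>
definition cochains ::
    "('g, 'x) monoid_scheme \<Rightarrow> ('a, 'y) monoid_scheme \<Rightarrow> nat \<Rightarrow> ('g list \<Rightarrow> 'a) monoid" where
  "cochains G M n = product_group (tuples G n) (\<lambda>_. M)"

text \<open>Tuples are indexed from 0, so the usual \<open>g\<^sub>j\<close> is \<open>gs ! (j - 1)\<close>.\<close>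
definition differential ::
    "('g, 'x) monoid_scheme \<Rightarrow> ('a, 'y) monoid_scheme \<Rightarrow> ('g \<Rightarrow> 'a \<Rightarrow> 'a) \<Rightarrow> nat \<Rightarrow>
     ('g list \<Rightarrow> 'a) \<Rightarrow> 'g list \<Rightarrow> 'a" where
  "differential G M act n \<phi> = (\<lambda>gs \<in> tuples G (Suc n).
     act (hd gs) (\<phi> (tl gs))
     \<otimes>\<^bsub>M\<^esub> (\<Otimes>\<^bsub>M\<^esub>j\<in>{1..n}.
           \<phi> (take (j - 1) gs @ [gs ! (j - 1) \<otimes>\<^bsub>G\<^esub> gs ! j] @ drop (j + 1) gs) [^]\<^bsub>M\<^esub> ((-1) ^ j :: int))
     \<otimes>\<^bsub>M\<^esub> \<phi> (butlast gs) [^]\<^bsub>M\<^esub> ((-1) ^ (n + 1) :: int))"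


section \<open>Symmetric cohomology\<close>

text \<open>
  \<open>(g\<^sub>1,\<dots>,g\<^sub>n) \<mapsto> (g\<^sub>1,\<dots>,g\<^sub>i\<^sub>-\<^sub>1 g\<^sub>i, g\<^sub>i\<^sup>-\<^sup>1, g\<^sub>i g\<^sub>i\<^sub>+\<^sub>1,\<dots>,g\<^sub>n)\<close>, where the entries at positions \<open>i - 1\<close> and
  \<open>i + 1\<close> are present only if these positions are (so for \<open>n = 1\<close> this is \<open>g\<^sub>1 \<mapsto> g\<^sub>1\<^sup>-\<^sup>1\<close>).
\<close>
definition transpose_tuple :: "('g, 'x) monoid_scheme \<Rightarrow> nat \<Rightarrow> 'g list \<Rightarrow> 'g list" where
  "transpose_tuple G i gs =
     (let g = (\<lambda>k. gs ! (k - 1)) in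
      map (\<lambda>k. if k + 1 = i then g k \<otimes>\<^bsub>G\<^esub> g i
               else if k = i then inv\<^bsub>G\<^esub> (g i)
               else if k = i + 1 then g i \<otimes>\<^bsub>G\<^esub> g k
               else g k) [1..<Suc (length gs)])"

text \<open>The action of \<open>\<sigma>\<^sub>i = (i, i+1) \<in> \<Sigma>\<^sub>n\<^sub>+\<^sub>1\<close> on \<open>C\<^sup>n(G,M)\<close>, for \<open>1 \<le> i \<le> n\<close>.\<close>
definition transposition_op ::
    "('g, 'x) monoid_scheme \<Rightarrow> ('a, 'y) monoid_scheme \<Rightarrow> ('g \<Rightarrow> 'a \<Rightarrow> 'a) \<Rightarrow> nat \<Rightarrow> nat \<Rightarrow>
     ('g list \<Rightarrow> 'a) \<Rightarrow> 'g list \<Rightarrow> 'a" where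
  "transposition_op G M act n i = (\<lambda>\<phi> \<in> carrier (cochains G M n). \<lambda>gs \<in> tuples G n.
     inv\<^bsub>M\<^esub> (if i = 1 then act (hd gs) (\<phi> (transpose_tuple G i gs))
            else \<phi> (transpose_tuple G i gs)))"

text \<open>
  As the \<open>\<sigma>\<^sub>i\<close> generate \<open>\<Sigma>\<^sub>n\<^sub>+\<^sub>1\<close>, the group of operators generated by their actions is the image of
  \<open>\<Sigma>\<^sub>n\<^sub>+\<^sub>1\<close> in the bijections of \<open>C\<^sup>n(G,M)\<close>, and \<open>CS\<^sup>n(G,M)\<close> is the group of its invariants.
\<close>
definition sym_operators ::
    "('g, 'x) monoid_scheme \<Rightarrow> ('a, 'y) monoid_scheme \<Rightarrow> ('g \<Rightarrow> 'a \<Rightarrow> 'a) \<Rightarrow> nat \<Rightarrow>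
     (('g list \<Rightarrow> 'a) \<Rightarrow> ('g list \<Rightarrow> 'a)) set" where
  "sym_operators G M act n =
     generate (BijGroup (carrier (cochains G M n))) (transposition_op G M act n ` {1..n})"

definition sym_cochains ::
    "('g, 'x) monoid_scheme \<Rightarrow> ('a, 'y) monoid_scheme \<Rightarrow> ('g \<Rightarrow> 'a \<Rightarrow> 'a) \<Rightarrow> nat \<Rightarrow>
     ('g list \<Rightarrow> 'a) monoid" where
  "sym_cochains G M act n = (cochains G M n)
     \<lparr>carrier := {\<phi> \<in> carrier (cochains G M n). \<forall>T \<in> sym_operators G M act n. T \<phi> = \<phi>}\<rparr>"

definition sym_cocycles ::
    "('g, 'x) monoid_scheme \<Rightarrow> ('a, 'y) monoid_scheme \<Rightarrow> ('g \<Rightarrow> 'a \<Rightarrow> 'a) \<Rightarrow> nat \<Rightarrow>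
     ('g list \<Rightarrow> 'a) set" where
  "sym_cocycles G M act n =
     kernel (cochains G M n) (cochains G M (Suc n)) (differential G M act n)
     \<inter> carrier (sym_cochains G M act n)"

primrec sym_coboundaries ::
    "('g, 'x) monoid_scheme \<Rightarrow> ('a, 'y) monoid_scheme \<Rightarrow> ('g \<Rightarrow> 'a \<Rightarrow> 'a) \<Rightarrow> nat \<Rightarrow>
     ('g list \<Rightarrow> 'a) set" where
  "sym_coboundaries G M act 0 = {\<one>\<^bsub>cochains G M 0\<^esub>}"
| "sym_coboundaries G M act (Suc n) =
     differential G M act n ` carrier (sym_cochains G M act n)"

definition HS ::
    "('g, 'x) monoid_scheme \<Rightarrow> ('a, 'y) monoid_scheme \<Rightarrow> ('g \<Rightarrow> 'a \<Rightarrow> 'a) \<Rightarrow> nat \<Rightarrow>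
     ('g list \<Rightarrow> 'a) set monoid" where
  "HS G M act n =
     (cochains G M n)\<lparr>carrier := sym_cocycles G M act n\<rparr> Mod sym_coboundaries G M act n"

definition sym_class ::
    "('g, 'x) monoid_scheme \<Rightarrow> ('a, 'y) monoid_scheme \<Rightarrow> ('g \<Rightarrow> 'a \<Rightarrow> 'a) \<Rightarrow> nat \<Rightarrow>
     ('g list \<Rightarrow> 'a) \<Rightarrow> ('g list \<Rightarrow> 'a) set" where
  "sym_class G M act n \<phi> = sym_coboundaries G M act n #>\<^bsub>cochains G M n\<^esub> \<phi>"


section \<open>The connecting homomorphism\<close>

text \<open>Post-composition of an \<open>n\<close>-cochain with a map (not necessarily a homomorphism).\<close>
definition push :: "('g, 'x) monoid_scheme \<Rightarrow> nat \<Rightarrow> ('a \<Rightarrow> 'b) \<Rightarrow> ('g list \<Rightarrow> 'a) \<Rightarrow> 'g list \<Rightarrow> 'b" where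
  "push G n f \<phi> = compose (tuples G n) f \<phi>"

text \<open>
  The map \<open>[\<phi>] \<mapsto> [f \<circ> \<phi>]\<close> into \<open>HS\<^sup>n(G,N)\<close> induced by a homomorphism \<open>f\<close> of \<open>G\<close>-modules; the union
  runs over the representatives of a class, all of which contribute the same coset.
\<close>
definition HS_map ::
    "('g, 'x) monoid_scheme \<Rightarrow> ('b, 'y) monoid_scheme \<Rightarrow> ('g \<Rightarrow> 'b \<Rightarrow> 'b) \<Rightarrow> nat \<Rightarrow> ('a \<Rightarrow> 'b) \<Rightarrow>
     ('g list \<Rightarrow> 'a) set \<Rightarrow> ('g list \<Rightarrow> 'b) set" where
  "HS_map G N actN n f X = (\<Union>\<phi>\<in>X. sym_class G N actN n (push G n f \<phi>))"

text \<open>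
  \<open>\<beta>\<^sub>G\<^sup>n(\<phi>) = r\<^sub>\<iota> \<circ> \<partial>\<^sub>B\<^sup>n(s\<^sub>\<pi> \<circ> \<phi>)\<close>, with \<open>r\<^sub>\<iota>\<close> the inverse of \<open>\<iota>\<close> on its image.
\<close>
definition beta_cochain ::
    "('g, 'x) monoid_scheme \<Rightarrow> ('a, 'y) monoid_scheme \<Rightarrow> ('b, 'z) monoid_scheme \<Rightarrow>
     ('g \<Rightarrow> 'b \<Rightarrow> 'b) \<Rightarrow> ('a \<Rightarrow> 'b) \<Rightarrow> ('c \<Rightarrow> 'b) \<Rightarrow> nat \<Rightarrow> ('g list \<Rightarrow> 'c) \<Rightarrow> 'g list \<Rightarrow> 'a" where
  "beta_cochain G A B actB \<iota> s n \<phi> =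
     push G (Suc n) (inv_into (carrier A) \<iota>) (differential G B actB n (push G n s \<phi>))"

definition short_exact_sym_complexes ::
    "('g, 'x) monoid_scheme \<Rightarrow> ('a, 'u) monoid_scheme \<Rightarrow> ('g \<Rightarrow> 'a \<Rightarrow> 'a) \<Rightarrow>
     ('b, 'v) monoid_scheme \<Rightarrow> ('g \<Rightarrow> 'b \<Rightarrow> 'b) \<Rightarrow> ('c, 'w) monoid_scheme \<Rightarrow> ('g \<Rightarrow> 'c \<Rightarrow> 'c) \<Rightarrow>
     ('a \<Rightarrow> 'b) \<Rightarrow> ('b \<Rightarrow> 'c) \<Rightarrow> bool" where
  "short_exact_sym_complexes G A actA B actB C actC \<iota> \<pi> \<longleftrightarrow>
     (\<forall>m. short_exact (sym_cochains G A actA m) (sym_cochains G B actB m) (sym_cochains G C actC m)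
            (push G m \<iota>) (push G m \<pi>)
        \<and> (\<forall>\<chi> \<in> carrier (sym_cochains G A actA m).
             push G (Suc m) \<iota> (differential G A actA m \<chi>) = differential G B actB m (push G m \<iota> \<chi>))
        \<and> (\<forall>\<psi> \<in> carrier (sym_cochains G B actB m).
             push G (Suc m) \<pi> (differential G B actB m \<psi>) = differential G C actC m (push G m \<pi> \<psi>)))"

text \<open>
  The relation of the snake lemma: lift a cocycle representing \<open>X\<close> along \<open>\<pi>\<close>, apply the
  differential, pull back along \<open>\<iota>\<close>, and take the class \<open>Y\<close> of the result.
\<close>
definition snake ::
    "('g, 'x) monoid_scheme \<Rightarrow> ('a, 'u) monoid_scheme \<Rightarrow> ('g \<Rightarrow> 'a \<Rightarrow> 'a) \<Rightarrow>
     ('b, 'v) monoid_scheme \<Rightarrow> ('g \<Rightarrow> 'b \<Rightarrow> 'b) \<Rightarrow> ('c, 'w) monoid_scheme \<Rightarrow> ('g \<Rightarrow> 'c \<Rightarrow> 'c) \<Rightarrow>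
     ('a \<Rightarrow> 'b) \<Rightarrow> ('b \<Rightarrow> 'c) \<Rightarrow> nat \<Rightarrow> ('g list \<Rightarrow> 'c) set \<Rightarrow> ('g list \<Rightarrow> 'a) set \<Rightarrow> bool" where
  "snake G A actA B actB C actC \<iota> \<pi> n X Y \<longleftrightarrow>
     (\<exists>\<phi> \<in> sym_cocycles G C actC n. \<exists>\<psi> \<in> carrier (sym_cochains G B actB n).
      \<exists>\<chi> \<in> carrier (sym_cochains G A actA (Suc n)).
        X = sym_class G C actC n \<phi> \<and> push G n \<pi> \<psi> = \<phi> \<and>
        push G (Suc n) \<iota> \<chi> = differential G B actB n \<psi> \<and> Y = sym_class G A actA (Suc n) \<chi>)"

text \<open>
  \<open>\<delta>\<close> is the connecting homomorphism \<open>HS\<^sup>n(G,C) \<rightarrow> HS\<^sup>n\<^sup>+\<^sup>1(G,A)\<close> of the long exact sequence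
  of the short exact sequence of complexes \<open>CS\<^sup>*(G,A) \<rightarrow> CS\<^sup>*(G,B) \<rightarrow> CS\<^sup>*(G,C)\<close>: its graph is the
  snake relation, and
  \<open>HS\<^sup>n(G,A) \<rightarrow> HS\<^sup>n(G,B) \<rightarrow> HS\<^sup>n(G,C) \<rightarrow> HS\<^sup>n\<^sup>+\<^sup>1(G,A) \<rightarrow> HS\<^sup>n\<^sup>+\<^sup>1(G,B) \<rightarrow> HS\<^sup>n\<^sup>+\<^sup>1(G,C)\<close> is exact
  at its four inner terms.
\<close>
definition is_connecting_hom ::
    "('g, 'x) monoid_scheme \<Rightarrow> ('a, 'u) monoid_scheme \<Rightarrow> ('g \<Rightarrow> 'a \<Rightarrow> 'a) \<Rightarrow>
     ('b, 'v) monoid_scheme \<Rightarrow> ('g \<Rightarrow> 'b \<Rightarrow> 'b) \<Rightarrow> ('c, 'w) monoid_scheme \<Rightarrow> ('g \<Rightarrow> 'c \<Rightarrow> 'c) \<Rightarrow>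
     ('a \<Rightarrow> 'b) \<Rightarrow> ('b \<Rightarrow> 'c) \<Rightarrow> nat \<Rightarrow> (('g list \<Rightarrow> 'c) set \<Rightarrow> ('g list \<Rightarrow> 'a) set) \<Rightarrow> bool" where
  "is_connecting_hom G A actA B actB C actC \<iota> \<pi> n \<delta> \<longleftrightarrow>
     group_hom (HS G C actC n) (HS G A actA (Suc n)) \<delta>
   \<and> short_exact_sym_complexes G A actA B actB C actC \<iota> \<pi>
   \<and> (\<forall>X \<in> carrier (HS G C actC n). \<forall>Y.
        \<delta> X = Y \<longleftrightarrow> snake G A actA B actB C actC \<iota> \<pi> n X Y)
   \<and> kernel (HS G B actB n) (HS G C actC n) (HS_map G C actC n \<pi>)
       = HS_map G B actB n \<iota> ` carrier (HS G A actA n)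
   \<and> kernel (HS G C actC n) (HS G A actA (Suc n)) \<delta>
       = HS_map G C actC n \<pi> ` carrier (HS G B actB n)
   \<and> kernel (HS G A actA (Suc n)) (HS G B actB (Suc n)) (HS_map G B actB (Suc n) \<iota>)
       = \<delta> ` carrier (HS G C actC n)
   \<and> kernel (HS G B actB (Suc n)) (HS G C actC (Suc n)) (HS_map G C actC (Suc n) \<pi>)
       = HS_map G B actB (Suc n) \<iota> ` carrier (HS G A actA (Suc n))"

end

theory Submission
  imports Defs "HOL-Combinatorics.Transposition"
begin

text \<open>
  Modules are written additively in these explanations. The snake lemma yields a connecting homomorphism once
  \<open>0 \<rightarrow> CS\<^sup>*(G,A) \<rightarrow> CS\<^sup>*(G,B) \<rightarrow> CS\<^sup>*(G,C) \<rightarrow> 0\<close> is a short exact sequence of complexes. Only surjectivity on the right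
  can fail for a general extension, and it is provided by \<open>s\<close>: since \<open>s\<close> is equivariant and commutes with
  inversion, \<open>s \<circ> \<phi>\<close> is again symmetric if \<open>\<phi>\<close> is, and it lifts \<open>\<phi>\<close> (\<open>short_exact_sym_cochains\<close>). Computing the
  connecting homomorphism with this particular lift gives the formula \<open>r\<^sub>\<iota> \<circ> \<partial>(s \<circ> \<phi>)\<close> (\<open>zigzag_beta\<close>). That \<open>s\<close>
  may fail to be additive does no harm, because the class obtained is independent of the lift
  (\<open>zigzag_class_eq\<close>), so additivity can be checked with the product of two lifts.

  What remains is that symmetric cochains form a complex at all: \<open>\<partial>\<partial> = 0\<close> and \<open>\<partial>(CS\<^sup>n) \<subseteq> CS\<^sup>n\<^sup>+\<^sup>1\<close>. Both are
  opaque in the inhomogeneous formulas and evident in the homogeneous form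
  \<open>\<Phi>(x\<^sub>0,\<dots>,x\<^sub>n) = x\<^sub>0 \<phi>(x\<^sub>0\<^sup>-\<^sup>1 x\<^sub>1,\<dots>,x\<^sub>n\<^sub>-\<^sub>1\<^sup>-\<^sup>1 x\<^sub>n)\<close>. There \<open>\<partial>\<close> is the alternating sum over the faces, which forget
  one vertex (\<open>homogeneous_differential\<close>), and \<open>\<sigma>\<^sub>i\<close> swaps two neighbouring vertices and changes the sign
  (\<open>homogeneous_transposition_op\<close>). Thus a cochain is symmetric iff its homogeneous form is
  alternating, and the boundary of an alternating function is alternating.
\<close>

section \<open>Finite products in abelian groups\<close>

lemma group_hom_finprod:
  assumes "group_hom M N h" "comm_group M" "comm_group N" and "f \<in> J \<rightarrow> carrier M"
  shows "h (finprod M f J) = finprod N (\<lambda>j. h (f j)) J"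
proof -
  interpret h: group_hom M N h by fact
  interpret M: comm_group M by fact
  interpret N: comm_group N by fact
  show ?thesis
    using assms(4) by (induction J rule: infinite_finite_induct) (auto simp: Pi_iff)
qed

context comm_group
begin

lemma group_hom_inv: "group_hom G G (m_inv G)"
  by unfold_locales (auto simp: hom_def inv_mult)

lemma group_hom_int_pow: "group_hom G G (\<lambda>x. x [^] (i :: int))"
  by unfold_locales (auto simp: hom_def int_pow_distrib)

text \<open>
  This is the bookkeeping behind \<open>\<partial>\<partial> = 0\<close>: for \<open>i \<le> j\<close> the entries at \<open>(i, j)\<close> and \<open>(j + 1, i)\<close> are inverse
  to each other, and these pairs exhaust the \<open>(n + 1) \<times> n\<close> array. Going from \<open>n\<close> to \<open>n + 1\<close> adds a
  column and a row, which cancel.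
\<close>
lemma finprod_simplicial_cancel:
  assumes closed: "\<And>i j. a i j \<in> carrier G"
    and cancel: "\<And>i j. i \<le> j \<Longrightarrow> j < n \<Longrightarrow> a i j = inv (a (Suc j) i)"
  shows "(\<Otimes>i\<in>{..n}. \<Otimes>j\<in>{..<n}. a i j) = \<one>"
  using cancel
proof (induction n)
  case (Suc n)
  have row: "(\<Otimes>j\<in>{..<Suc n}. a i j) = (\<Otimes>j\<in>{..<n}. a i j) \<otimes> a i n" for i
    using closed by (simp add: lessThan_Suc m_comm Pi_iff finprod_closed)
  have "(\<Otimes>i\<in>{..Suc n}. \<Otimes>j\<in>{..<Suc n}. a i j)
      = (\<Otimes>j\<in>{..<Suc n}. a (Suc n) j) \<otimes> (\<Otimes>i\<in>{..n}. (\<Otimes>j\<in>{..<n}. a i j) \<otimes> a i n)"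
    using closed by (simp add: atMost_Suc Pi_iff finprod_closed flip: row)
  also have "(\<Otimes>i\<in>{..n}. (\<Otimes>j\<in>{..<n}. a i j) \<otimes> a i n) = (\<Otimes>i\<in>{..n}. a i n)"
    using closed Suc by (simp add: Pi_iff finprod_closed)
  also have "\<dots> = (\<Otimes>i\<in>{..<Suc n}. inv (a (Suc n) i))"
    using closed Suc.prems by (intro finprod_cong') (auto simp: lessThan_Suc_atMost)
  also have "\<dots> = inv (\<Otimes>i\<in>{..<Suc n}. a (Suc n) i)"
    using closed by (intro group_hom_finprod[symmetric] group_hom_inv comm_group_axioms) auto
  finally show ?case
    using closed by (simp add: finprod_closed Pi_iff del: finprod_insert)
qed simp

end

section \<open>Homogeneous form of a cochain\<close>

text \<open>
  A homogeneous tuple \<open>(x\<^sub>0,\<dots>,x\<^sub>n)\<close> is represented by a map on all of \<open>nat\<close>, so that faces and transpositions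
  are given by formulas that do not mention \<open>n\<close>. The list of its consecutive quotients \<open>x\<^sub>k\<^sup>-\<^sup>1 x\<^sub>k\<^sub>+\<^sub>1\<close> is the
  corresponding inhomogeneous tuple.
\<close>
definition steps :: "('g, 'x) monoid_scheme \<Rightarrow> nat \<Rightarrow> (nat \<Rightarrow> 'g) \<Rightarrow> 'g list" where
  "steps G n x = map (\<lambda>k. inv\<^bsub>G\<^esub> (x k) \<otimes>\<^bsub>G\<^esub> x (Suc k)) [0..<n]"

text \<open>
  The section \<open>(g\<^sub>1,\<dots>,g\<^sub>n) \<mapsto> (1, g\<^sub>1, g\<^sub>1 g\<^sub>2,\<dots>)\<close> of \<open>steps\<close>, continued constantly.
\<close>
primrec partial_prods :: "('g, 'x) monoid_scheme \<Rightarrow> 'g list \<Rightarrow> nat \<Rightarrow> 'g" where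
  "partial_prods G gs 0 = \<one>\<^bsub>G\<^esub>"
| "partial_prods G gs (Suc k) = partial_prods G gs k \<otimes>\<^bsub>G\<^esub> (if k < length gs then gs ! k else \<one>\<^bsub>G\<^esub>)"

text \<open>
  The equivariant function that corresponds to \<open>\<phi>\<close> under the passage to homogeneous cochains,
  \<open>(x\<^sub>0,\<dots>,x\<^sub>n) \<mapsto> x\<^sub>0 \<phi>(x\<^sub>0\<^sup>-\<^sup>1 x\<^sub>1,\<dots>,x\<^sub>n\<^sub>-\<^sub>1\<^sup>-\<^sup>1 x\<^sub>n)\<close>.
\<close>
definition homogeneous ::
    "('g, 'x) monoid_scheme \<Rightarrow> ('g \<Rightarrow> 'a \<Rightarrow> 'a) \<Rightarrow> nat \<Rightarrow> ('g list \<Rightarrow> 'a) \<Rightarrow> (nat \<Rightarrow> 'g) \<Rightarrow> 'a" where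
  "homogeneous G act n \<phi> x = act (x 0) (\<phi> (steps G n x))"

definition face :: "nat \<Rightarrow> (nat \<Rightarrow> 'g) \<Rightarrow> nat \<Rightarrow> 'g" where
  "face j x = (\<lambda>k. if k < j then x k else x (Suc k))"

lemma face_face: "i \<le> j \<Longrightarrow> face j (face i x) = face i (face (Suc j) x)"
  by (auto simp: face_def fun_eq_iff)

lemma face_transpose_above: "i < j \<Longrightarrow> face j (x \<circ> transpose (i - 1) i) = face j x \<circ> transpose (i - 1) i"
  by (auto simp: face_def fun_eq_iff transpose_def)

lemma face_transpose_below:
  "j < i - 1 \<Longrightarrow> face j (x \<circ> transpose (i - 1) i) = face j x \<circ> transpose (i - 1 - 1) (i - 1)"
  by (auto simp: face_def fun_eq_iff transpose_def)

lemma face_transpose_at: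
  assumes "1 \<le> i"
  shows "face i (x \<circ> transpose (i - 1) i) = face (i - 1) x"
    and "face (i - 1) (x \<circ> transpose (i - 1) i) = face i x"
  using assms by (auto simp: face_def fun_eq_iff transpose_def)

lemma length_steps [simp]: "length (steps G n x) = n"
  by (simp add: steps_def)

lemma nth_steps [simp]: "k < n \<Longrightarrow> steps G n x ! k = inv\<^bsub>G\<^esub> (x k) \<otimes>\<^bsub>G\<^esub> x (Suc k)"
  by (simp add: steps_def)

lemma tl_steps: "tl (steps G (Suc n) x) = steps G n (face 0 x)"
  by (rule nth_equalityI) (auto simp: nth_tl face_def)

lemma butlast_steps: "butlast (steps G (Suc n) x) = steps G n (face (Suc n) x)"
  by (rule nth_equalityI) (auto simp: nth_butlast face_def)

lemma hd_steps: "0 < n \<Longrightarrow> hd (steps G n x) = inv\<^bsub>G\<^esub> (x 0) \<otimes>\<^bsub>G\<^esub> x 1"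
  by (simp add: steps_def hd_map)

context group
begin

lemma steps_in_tuples: "(\<And>k. x k \<in> carrier G) \<Longrightarrow> steps G n x \<in> tuples G n"
  by (auto simp: steps_def tuples_def)

lemma partial_prods_closed: "gs \<in> tuples G n \<Longrightarrow> partial_prods G gs k \<in> carrier G"
  by (induction k) (auto simp: tuples_def dest!: nth_mem)

lemma inv_mult_cancel: "a \<in> carrier G \<Longrightarrow> b \<in> carrier G \<Longrightarrow> inv a \<otimes> (a \<otimes> b) = b"
  by (simp flip: m_assoc)

lemma mult_inv_cancel: "a \<in> carrier G \<Longrightarrow> b \<in> carrier G \<Longrightarrow> a \<otimes> (inv a \<otimes> b) = b"
  by (simp flip: m_assoc)

lemma steps_partial_prods: "gs \<in> tuples G n \<Longrightarrow> steps G n (partial_prods G gs) = gs"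
proof (rule nth_equalityI)
  fix k assume gs: "gs \<in> tuples G n" and "k < length (steps G n (partial_prods G gs))"
  then show "steps G n (partial_prods G gs) ! k = gs ! k"
    using partial_prods_closed[OF gs, of k] nth_mem[of k gs]
    by (auto simp: tuples_def inv_mult_cancel subset_iff)
qed (simp add: tuples_def)

lemma step_mult_step:
  assumes "a \<in> carrier G" "b \<in> carrier G" "c \<in> carrier G"
  shows "(inv a \<otimes> b) \<otimes> (inv b \<otimes> c) = inv a \<otimes> c"
  using assms by (simp add: m_assoc mult_inv_cancel)

text \<open>
  Multiplying two neighbouring entries of an inhomogeneous tuple is forgetting an interior vertex.
\<close>
lemma merge_steps:
  assumes x: "\<And>k. x k \<in> carrier G" and j: "1 \<le> j" "j \<le> n"
  defines "gs \<equiv> steps G (Suc n) x"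
  shows "take (j - 1) gs @ [gs ! (j - 1) \<otimes> gs ! j] @ drop (j + 1) gs = steps G n (face j x)"
proof (rule nth_equalityI)
  show len: "length (take (j - 1) gs @ [gs ! (j - 1) \<otimes> gs ! j] @ drop (j + 1) gs)
      = length (steps G n (face j x))"
    using j by (simp add: gs_def)
  fix k assume "k < length (take (j - 1) gs @ [gs ! (j - 1) \<otimes> gs ! j] @ drop (j + 1) gs)"
  then have k: "k < n" using len by simp
  consider "k < j - 1" | "k = j - 1" | "k \<ge> j" by linarith
  then show "(take (j - 1) gs @ [gs ! (j - 1) \<otimes> gs ! j] @ drop (j + 1) gs) ! k
      = steps G n (face j x) ! k"
  proof cases
    case 1
    then have "k < j" "Suc k < j" by simp_all
    then show ?thesis using 1 j k by (simp add: gs_def nth_append face_def)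
  next
    case 2
    then show ?thesis using j k x
      by (simp add: gs_def nth_append face_def step_mult_step)
  next
    case 3
    then have "k - (j - 1) = Suc (k - j)" "\<not> k < j - 1" using j by simp_all
    then show ?thesis using j k 3 by (simp add: gs_def nth_append face_def)
  qed
qed

text \<open>
  In homogeneous coordinates the operation behind \<open>\<sigma>\<^sub>i\<close> merely swaps two neighbouring vertices. Vertices are
  numbered from 0, so these are \<open>i - 1\<close> and \<open>i\<close>.
\<close>
lemma transpose_steps:
  assumes x: "\<And>k. x k \<in> carrier G" and i: "1 \<le> i" "i \<le> n"
  shows "transpose_tuple G i (steps G n x) = steps G n (x \<circ> transpose (i - 1) i)"
proof (rule nth_equalityI)
  show len: "length (transpose_tuple G i (steps G n x)) = length (steps G n (x \<circ> transpose (i - 1) i))"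
    by (simp add: transpose_tuple_def)
  fix k assume "k < length (transpose_tuple G i (steps G n x))"
  then have k: "k < n" using len by simp
  \<comment> \<open>The entries of a list are numbered from 0, those in the formula for the transposition from 1.\<close>
  have eq: "transpose_tuple G i (steps G n x) ! k =
      (if k + 2 = i then (inv x k \<otimes> x (Suc k)) \<otimes> (inv x (Suc k) \<otimes> x (Suc (Suc k)))
       else if k + 1 = i then inv (inv x k \<otimes> x (Suc k))
       else if k = i then (inv x (k - 1) \<otimes> x k) \<otimes> (inv x k \<otimes> x (Suc k))
       else inv x k \<otimes> x (Suc k))"
    using k i by (auto simp: transpose_tuple_def Let_def simp del: upt_Suc)
  obtain m where m: "i = Suc m"
    using i by (cases i) auto
  consider "m = k + 1" | "m = k" | "k = Suc m" | "k \<noteq> m" "k \<noteq> Suc m" "Suc k \<noteq> m"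
    by linarith
  then show "transpose_tuple G i (steps G n x) ! k = steps G n (x \<circ> transpose (i - 1) i) ! k"
    unfolding eq using k x
    by cases (auto simp: m step_mult_step inv_mult_group transpose_def)
qed

end

section \<open>The differential in homogeneous form\<close>

sublocale G_module \<subseteq> G: group G
  using group_hom by (rule group_hom.axioms(1))

context G_module
begin

lemma act_closed: "g \<in> carrier G \<Longrightarrow> a \<in> carrier M \<Longrightarrow> act g a \<in> carrier M"
  using element_image by blast

lemma act_group_hom: "g \<in> carrier G \<Longrightarrow> group_hom M M (act g)"
  using act_hom by (intro group_hom.intro M.group_axioms) (simp add: group_hom_axioms_def)

lemma act_one: "a \<in> carrier M \<Longrightarrow> act \<one>\<^bsub>G\<^esub> a = a"
  using id_eq_one by (metis restrict_apply')

lemma act_mult: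
  "g \<in> carrier G \<Longrightarrow> h \<in> carrier G \<Longrightarrow> a \<in> carrier M \<Longrightarrow> act g (act h a) = act (g \<otimes>\<^bsub>G\<^esub> h) a"
  by (simp add: composition_rule)

lemma cochain_closed: "\<phi> \<in> carrier (cochains G M n) \<Longrightarrow> gs \<in> tuples G n \<Longrightarrow> \<phi> gs \<in> carrier M"
  by (auto simp: cochains_def)

lemma comm_group_cochains: "comm_group (cochains G M n)"
proof (rule group.group_comm_groupI)
  show "Group.group (cochains G M n)"
    by (simp add: cochains_def M.group_axioms)
qed (auto simp: cochains_def restrict_def fun_eq_iff M.m_comm PiE_iff)

lemma homogeneous_closed:
  assumes "\<phi> \<in> carrier (cochains G M n)" "\<And>k. x k \<in> carrier G"
  shows "homogeneous G act n \<phi> x \<in> carrier M"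
  unfolding homogeneous_def using assms(2)
  by (intro act_closed cochain_closed[OF assms(1)] G.steps_in_tuples)

lemma homogeneous_partial_prods:
  assumes "\<phi> \<in> carrier (cochains G M n)" "gs \<in> tuples G n"
  shows "homogeneous G act n \<phi> (partial_prods G gs) = \<phi> gs"
  using assms by (simp add: homogeneous_def G.steps_partial_prods act_one cochain_closed)

text \<open>
  A cochain is recovered from its homogeneous form by evaluation at partial products, so identities
  between cochains may be checked in homogeneous coordinates.
\<close>
lemma cochain_eqI:
  assumes "\<phi> \<in> carrier (cochains G M n)" "\<psi> \<in> carrier (cochains G M n)"
    and "\<And>x. (\<And>k. x k \<in> carrier G) \<Longrightarrow> homogeneous G act n \<phi> x = homogeneous G act n \<psi> x"
  shows "\<phi> = \<psi>"
proof (rule PiE_ext)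
  show "\<phi> \<in> tuples G n \<rightarrow>\<^sub>E carrier M" "\<psi> \<in> tuples G n \<rightarrow>\<^sub>E carrier M"
    using assms by (auto simp: cochains_def)
  fix gs assume gs: "gs \<in> tuples G n"
  have "homogeneous G act n \<phi> (partial_prods G gs) = homogeneous G act n \<psi> (partial_prods G gs)"
    by (rule assms(3)) (rule G.partial_prods_closed[OF gs])
  then show "\<phi> gs = \<psi> gs"
    using assms gs by (simp add: homogeneous_partial_prods)
qed

lemma homogeneous_mult:
  assumes "\<phi> \<in> carrier (cochains G M n)" "\<psi> \<in> carrier (cochains G M n)" "\<And>k. x k \<in> carrier G"
  shows "homogeneous G act n (\<phi> \<otimes>\<^bsub>cochains G M n\<^esub> \<psi>) x
    = homogeneous G act n \<phi> x \<otimes>\<^bsub>M\<^esub> homogeneous G act n \<psi> x"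
proof -
  interpret g: group_hom M M "act (x 0)"
    using assms(3) by (rule act_group_hom)
  show ?thesis
    using G.steps_in_tuples[of x n, OF assms(3)] assms(1,2)[THEN cochain_closed]
    by (simp add: homogeneous_def) (simp add: cochains_def)
qed

lemma differential_closed:
  assumes "\<phi> \<in> carrier (cochains G M n)"
  shows "differential G M act n \<phi> \<in> carrier (cochains G M (Suc n))"
proof -
  have "act (hd gs) (\<phi> (tl gs)) \<in> carrier M" "\<phi> (butlast gs) \<in> carrier M"
    "j \<in> {1..n} \<Longrightarrow> \<phi> (take (j - 1) gs @ [gs ! (j - 1) \<otimes>\<^bsub>G\<^esub> gs ! j] @ drop (j + 1) gs) \<in> carrier M"
    if gs: "gs \<in> tuples G (Suc n)" for gs j
  proof -
    have x: "partial_prods G gs k \<in> carrier G" for k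
      using gs by (rule G.partial_prods_closed)
    have eq: "gs = steps G (Suc n) (partial_prods G gs)"
      using gs by (simp add: G.steps_partial_prods)
    have ft: "steps G n (face j (partial_prods G gs)) \<in> tuples G n" for j
      by (rule G.steps_in_tuples) (simp add: face_def x del: partial_prods.simps)
    have "hd gs \<in> carrier G"
      using gs by (cases gs) (auto simp: tuples_def)
    then show "act (hd gs) (\<phi> (tl gs)) \<in> carrier M"
      by (subst (2) eq, subst tl_steps) (intro act_closed cochain_closed[OF assms] ft)
    show "\<phi> (butlast gs) \<in> carrier M"
      by (subst eq, subst butlast_steps) (intro cochain_closed[OF assms] ft)
    show "\<phi> (take (j - 1) gs @ [gs ! (j - 1) \<otimes>\<^bsub>G\<^esub> gs ! j] @ drop (j + 1) gs) \<in> carrier M"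
      if "j \<in> {1..n}"
    proof -
      have "take (j - 1) gs @ [gs ! (j - 1) \<otimes>\<^bsub>G\<^esub> gs ! j] @ drop (j + 1) gs
          = steps G n (face j (partial_prods G gs))"
        using that G.merge_steps[of "partial_prods G gs" j n, OF x] by (simp flip: eq)
      then show ?thesis by (simp only: cochain_closed[OF assms ft])
    qed
  qed
  then show ?thesis
    unfolding differential_def cochains_def
    by (auto intro!: M.m_closed M.int_pow_closed M.finprod_closed simp del: append.simps)
qed

text \<open>
  The three kinds of terms of the inhomogeneous differential become uniform: the first one is the face
  that forgets \<open>x\<^sub>0\<close> (the factor \<open>g\<^sub>1 = x\<^sub>0\<^sup>-\<^sup>1 x\<^sub>1\<close> moves the base vertex to \<open>x\<^sub>1\<close>), the middle ones forget an
  interior vertex, and the last one forgets the last vertex.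
\<close>
lemma homogeneous_differential:
  assumes \<phi>: "\<phi> \<in> carrier (cochains G M n)" and x: "\<And>k. x k \<in> carrier G"
  shows "homogeneous G act (Suc n) (differential G M act n \<phi>) x
    = (\<Otimes>\<^bsub>M\<^esub>j\<in>{..Suc n}. homogeneous G act n \<phi> (face j x) [^]\<^bsub>M\<^esub> ((-1) ^ j :: int))"
proof -
  interpret g: group_hom M M "act (x 0)"
    using x by (rule act_group_hom)
  define gs where "gs = steps G (Suc n) x"
  define p where "p j = homogeneous G act n \<phi> (face j x) [^]\<^bsub>M\<^esub> ((-1) ^ j :: int)" for j
  define m where "m j = \<phi> (take (j - 1) gs @ [gs ! (j - 1) \<otimes>\<^bsub>G\<^esub> gs ! j] @ drop (j + 1) gs)" for j
  have gs: "gs \<in> tuples G (Suc n)"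
    unfolding gs_def using x by (rule G.steps_in_tuples)
  have fx: "face j x k \<in> carrier G" for j k
    using x by (simp add: face_def)
  have p: "p j \<in> carrier M" for j
    using homogeneous_closed[OF \<phi>, of "face j x", OF fx] by (simp add: p_def)
  have ft: "\<phi> (steps G n (face j x)) \<in> carrier M" for j
    by (intro cochain_closed[OF \<phi>] G.steps_in_tuples fx)
  have m: "m j = \<phi> (steps G n (face j x))" if "j \<in> {1..n}" for j
    using G.merge_steps[of x j n, OF x] that by (simp only: m_def gs_def atLeastAtMost_iff)
  have first: "act (x 0) (act (hd gs) (\<phi> (tl gs))) = p 0"
    using x ft[of 0]
    by (simp add: p_def gs_def homogeneous_def tl_steps hd_steps act_mult G.mult_inv_cancel act_closed)
      (simp add: face_def act_closed)
  have last: "act (x 0) (\<phi> (butlast gs) [^]\<^bsub>M\<^esub> ((-1) ^ (n + 1) :: int)) = p (Suc n)"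
    using x ft[of "Suc n"] g.hom_int_pow[OF ft, of "Suc n"]
    by (simp add: p_def gs_def homogeneous_def butlast_steps) (simp add: face_def)
  have middle: "act (x 0) (\<Otimes>\<^bsub>M\<^esub>j\<in>{1..n}. m j [^]\<^bsub>M\<^esub> ((-1) ^ j :: int)) = (\<Otimes>\<^bsub>M\<^esub>j\<in>{1..n}. p j)"
  proof -
    have "act (x 0) (m j [^]\<^bsub>M\<^esub> ((-1) ^ j :: int)) = p j" if "j \<in> {1..n}" for j
      using that g.hom_int_pow[OF ft] by (simp add: m p_def homogeneous_def face_def)
    then have "(\<Otimes>\<^bsub>M\<^esub>j\<in>{1..n}. p j) = (\<Otimes>\<^bsub>M\<^esub>j\<in>{1..n}. act (x 0) (m j [^]\<^bsub>M\<^esub> ((-1) ^ j :: int)))"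
      using p by (intro M.finprod_cong') auto
    also have "\<dots> = act (x 0) (\<Otimes>\<^bsub>M\<^esub>j\<in>{1..n}. m j [^]\<^bsub>M\<^esub> ((-1) ^ j :: int))"
      using ft m by (intro group_hom_finprod[symmetric] g.group_hom_axioms M.comm_group_axioms) auto
    finally show ?thesis by (rule sym)
  qed
  have mc: "(\<Otimes>\<^bsub>M\<^esub>j\<in>{1..n}. m j [^]\<^bsub>M\<^esub> ((-1) ^ j :: int)) \<in> carrier M"
    using ft m by (intro M.finprod_closed) auto
  have hc: "act (hd gs) (\<phi> (tl gs)) \<in> carrier M"
    using x ft[of 0] by (simp add: gs_def tl_steps hd_steps act_closed)
  have lc: "\<phi> (butlast gs) [^]\<^bsub>M\<^esub> ((-1) ^ (n + 1) :: int) \<in> carrier M"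
    using ft[of "Suc n"] by (simp add: gs_def butlast_steps)
  have "homogeneous G act (Suc n) (differential G M act n \<phi>) x
      = act (x 0) (act (hd gs) (\<phi> (tl gs)) \<otimes>\<^bsub>M\<^esub> (\<Otimes>\<^bsub>M\<^esub>j\<in>{1..n}. m j [^]\<^bsub>M\<^esub> ((-1) ^ j :: int))
        \<otimes>\<^bsub>M\<^esub> \<phi> (butlast gs) [^]\<^bsub>M\<^esub> ((-1) ^ (n + 1) :: int))"
    unfolding homogeneous_def gs_def[symmetric] differential_def m_def using gs by simp
  also have "\<dots> = p 0 \<otimes>\<^bsub>M\<^esub> (\<Otimes>\<^bsub>M\<^esub>j\<in>{1..n}. p j) \<otimes>\<^bsub>M\<^esub> p (Suc n)"
    using hc mc lc first middle last by (simp only: g.hom_mult M.m_closed)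
  also have "\<dots> = (\<Otimes>\<^bsub>M\<^esub>j\<in>insert 0 (insert (Suc n) {1..n}). p j)"
    using p by (simp add: M.m_ac M.finprod_closed Pi_iff)
  also have "insert 0 (insert (Suc n) {1..n}) = {..Suc n}"
    by auto
  finally show ?thesis by (simp add: p_def)
qed

end


section \<open>Symmetric cochains\<close>

text \<open>
  Since the symmetric group acts through the group generated by the transpositions, invariance has to be
  tested on generators only.
\<close>
lemma bij_group_generate_fixes:
  assumes F: "F \<subseteq> Bij S" and x: "x \<in> S" and fixed: "\<And>f. f \<in> F \<Longrightarrow> f x = x"
    and T: "T \<in> generate (BijGroup S) F"
  shows "T x = x"
proof -
  interpret S: group "BijGroup S" by (rule group_BijGroup)
  have F': "F \<subseteq> carrier (BijGroup S)"
    using F by (simp add: BijGroup_def)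
  have mult: "(f \<otimes>\<^bsub>BijGroup S\<^esub> g) x = f (g x)"
    if "f \<in> carrier (BijGroup S)" "g \<in> carrier (BijGroup S)" for f g
    using that x by (simp add: BijGroup_def compose_eq)
  show ?thesis
    using T
  proof (induction rule: generate.induct)
    case one
    then show ?case using x by (simp add: BijGroup_def)
  next
    case (incl f)
    then show ?case by (rule fixed)
  next
    case (inv f)
    then have f: "f \<in> carrier (BijGroup S)" using F' by blast
    then have "(inv\<^bsub>BijGroup S\<^esub> f \<otimes>\<^bsub>BijGroup S\<^esub> f) x = x"
      using x by (simp only: S.l_inv) (simp add: BijGroup_def)
    then show ?case
      using mult[OF S.inv_closed[OF f] f] fixed[OF inv] by simp
  next
    case (eng f g)
    then show ?case
      using S.generate_in_carrier[OF F'] by (simp add: mult)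
  qed
qed

context G_module
begin

sublocale K: comm_group "cochains G M n" for n
  by (rule comm_group_cochains)

lemma homogeneous_hom:
  "(\<And>k. x k \<in> carrier G) \<Longrightarrow> group_hom (cochains G M n) M (\<lambda>\<phi>. homogeneous G act n \<phi> x)"
  by unfold_locales (auto simp: hom_def homogeneous_closed homogeneous_mult)

lemma transposition_op_closed:
  assumes \<phi>: "\<phi> \<in> carrier (cochains G M n)" and i: "i \<in> {1..n}"
  shows "transposition_op G M act n i \<phi> \<in> carrier (cochains G M n)"
proof -
  have "transpose_tuple G i gs \<in> tuples G n \<and> hd gs \<in> carrier G" if gs: "gs \<in> tuples G n" for gs
  proof
    have x: "partial_prods G gs k \<in> carrier G" for k
      using gs by (rule G.partial_prods_closed)
    have "transpose_tuple G i gs = steps G n (partial_prods G gs \<circ> transpose (i - 1) i)"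
      using G.transpose_steps[of "partial_prods G gs" i n, OF x] i gs
      by (simp add: G.steps_partial_prods)
    then show "transpose_tuple G i gs \<in> tuples G n"
      using x by (simp add: G.steps_in_tuples)
    show "hd gs \<in> carrier G"
      using gs i by (cases gs) (auto simp: tuples_def)
  qed
  then show ?thesis
    using \<phi> cochain_closed[OF \<phi>]
    by (auto simp: transposition_op_def cochains_def intro!: act_closed M.inv_closed)
qed

lemma homogeneous_transposition_op:
  assumes \<phi>: "\<phi> \<in> carrier (cochains G M n)" and i: "i \<in> {1..n}" and x: "\<And>k. x k \<in> carrier G"
  shows "homogeneous G act n (transposition_op G M act n i \<phi>) x
    = inv\<^bsub>M\<^esub> homogeneous G act n \<phi> (x \<circ> transpose (i - 1) i)"
proof -
  interpret g: group_hom M M "act (x 0)"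
    using x by (rule act_group_hom)
  let ?y = "x \<circ> transpose (i - 1) i"
  have steps: "transpose_tuple G i (steps G n x) = steps G n ?y"
    using G.transpose_steps[of x i n, OF x] i by simp
  have c: "\<phi> (steps G n ?y) \<in> carrier M"
    using x by (intro cochain_closed[OF \<phi>] G.steps_in_tuples) simp
  show ?thesis
  proof (cases "i = 1")
    case True
    then have "act (x 0) (act (hd (steps G n x)) (\<phi> (steps G n ?y))) = act (?y 0) (\<phi> (steps G n ?y))"
      using x c i by (simp add: hd_steps act_mult G.mult_inv_cancel)
    moreover have "act (hd (steps G n x)) (\<phi> (steps G n ?y)) \<in> carrier M"
      using x c i True by (intro act_closed) (auto simp: hd_steps)
    ultimately show ?thesis
      using \<phi> True steps x
      by (simp add: homogeneous_def transposition_op_def G.steps_in_tuples)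
  next
    case False
    then have "?y 0 = x 0"
      using i by (auto simp: transpose_def)
    then show ?thesis
      using \<phi> False steps c x
      by (simp add: homogeneous_def transposition_op_def G.steps_in_tuples)
  qed
qed

text \<open>
  Being involutions, the operators are bijections; this is what places them in \<open>BijGroup\<close>, where
  the group that they generate is formed.
\<close>
lemma transposition_op_involution:
  assumes \<phi>: "\<phi> \<in> carrier (cochains G M n)" and i: "i \<in> {1..n}"
  shows "transposition_op G M act n i (transposition_op G M act n i \<phi>) = \<phi>"
proof (rule cochain_eqI)
  fix x :: "nat \<Rightarrow> 'a" assume x: "\<And>k. x k \<in> carrier G"
  then show "homogeneous G act n (transposition_op G M act n i (transposition_op G M act n i \<phi>)) x
      = homogeneous G act n \<phi> x"
    using assms by (simp add: homogeneous_transposition_op transposition_op_closed homogeneous_closed comp_assoc)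
qed (use \<phi> in \<open>simp_all add: transposition_op_closed[OF _ i]\<close>)

lemma transposition_op_Bij:
  assumes "i \<in> {1..n}"
  shows "transposition_op G M act n i \<in> Bij (carrier (cochains G M n))"
proof -
  have "bij_betw (transposition_op G M act n i) (carrier (cochains G M n)) (carrier (cochains G M n))"
    using assms transposition_op_closed transposition_op_involution
    by (intro bij_betw_byWitness[where f' = "transposition_op G M act n i"]) auto
  moreover have "transposition_op G M act n i \<in> extensional (carrier (cochains G M n))"
    by (simp add: transposition_op_def)
  ultimately show ?thesis
    by (simp add: Bij_def)
qed

lemma sym_cochains_iff_transposition_op:
  "\<phi> \<in> carrier (sym_cochains G M act n) \<longleftrightarrow>
     \<phi> \<in> carrier (cochains G M n) \<and> (\<forall>i\<in>{1..n}. transposition_op G M act n i \<phi> = \<phi>)"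
proof -
  have "T \<phi> = \<phi>"
    if "\<phi> \<in> carrier (cochains G M n)" "\<forall>i\<in>{1..n}. transposition_op G M act n i \<phi> = \<phi>"
      "T \<in> sym_operators G M act n" for T
    by (rule bij_group_generate_fixes[OF _ that(1) _ that(3)[unfolded sym_operators_def]])
      (use that(2) transposition_op_Bij in auto)
  then show ?thesis
    by (auto simp: sym_cochains_def sym_operators_def intro: generate.incl)
qed

text \<open>
  The sign in the definition of the operators turns symmetry of a cochain into alternation of its
  homogeneous form.
\<close>
lemma sym_cochains_iff_alternating:
  "\<phi> \<in> carrier (sym_cochains G M act n) \<longleftrightarrow>
     \<phi> \<in> carrier (cochains G M n) \<and>
     (\<forall>i\<in>{1..n}. \<forall>x. (\<forall>k. x k \<in> carrier G) \<longrightarrow>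
        homogeneous G act n \<phi> (x \<circ> transpose (i - 1) i) = inv\<^bsub>M\<^esub> homogeneous G act n \<phi> x)"
proof -
  have "transposition_op G M act n i \<phi> = \<phi> \<longleftrightarrow>
      (\<forall>x. (\<forall>k. x k \<in> carrier G) \<longrightarrow>
        homogeneous G act n \<phi> (x \<circ> transpose (i - 1) i) = inv\<^bsub>M\<^esub> homogeneous G act n \<phi> x)"
      (is "_ \<longleftrightarrow> ?R") if \<phi>: "\<phi> \<in> carrier (cochains G M n)" and i: "i \<in> {1..n}" for i
  proof
    assume eq: "transposition_op G M act n i \<phi> = \<phi>"
    show ?R
    proof (intro allI impI)
      fix x :: "nat \<Rightarrow> 'a" assume x: "\<forall>k. x k \<in> carrier G"
      then have "inv\<^bsub>M\<^esub> homogeneous G act n \<phi> (x \<circ> transpose (i - 1) i) = homogeneous G act n \<phi> x"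
        using homogeneous_transposition_op[OF \<phi> i, of x] eq by simp
      moreover have "homogeneous G act n \<phi> (x \<circ> transpose (i - 1) i) \<in> carrier M"
        using \<phi> x by (simp add: homogeneous_closed)
      ultimately show "homogeneous G act n \<phi> (x \<circ> transpose (i - 1) i) = inv\<^bsub>M\<^esub> homogeneous G act n \<phi> x"
        by (metis M.inv_inv)
    qed
  next
    assume ?R
    then show "transposition_op G M act n i \<phi> = \<phi>"
      using \<phi> i
      by (intro cochain_eqI[of _ n])
        (simp_all add: transposition_op_closed homogeneous_transposition_op homogeneous_closed)
  qed
  then show ?thesis
    by (auto simp: sym_cochains_iff_transposition_op)
qed

lemma sym_cochains_closed: "\<phi> \<in> carrier (sym_cochains G M act n) \<Longrightarrow> \<phi> \<in> carrier (cochains G M n)"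
  by (simp add: sym_cochains_def)

lemma sym_cochains_subgroup: "subgroup (carrier (sym_cochains G M act n)) (cochains G M n)"
proof (rule K.subgroupI)
  have "\<one>\<^bsub>cochains G M n\<^esub> \<in> carrier (sym_cochains G M act n)"
    using homogeneous_hom[THEN group_hom.hom_one]
    by (simp add: sym_cochains_iff_alternating)
  then show "carrier (sym_cochains G M act n) \<noteq> {}" by blast
next
  fix \<phi> assume "\<phi> \<in> carrier (sym_cochains G M act n)"
  then show "inv\<^bsub>cochains G M n\<^esub> \<phi> \<in> carrier (sym_cochains G M act n)"
    using homogeneous_hom[THEN group_hom.hom_inv]
    by (simp add: sym_cochains_iff_alternating)
next
  fix \<phi> \<psi> assume "\<phi> \<in> carrier (sym_cochains G M act n)" "\<psi> \<in> carrier (sym_cochains G M act n)"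
  then show "\<phi> \<otimes>\<^bsub>cochains G M n\<^esub> \<psi> \<in> carrier (sym_cochains G M act n)"
    by (simp add: sym_cochains_iff_alternating homogeneous_mult M.inv_mult homogeneous_closed)
qed (auto intro: sym_cochains_closed)

section \<open>Symmetric cochains form a subcomplex\<close>

lemma face_closed: "(\<And>k. x k \<in> carrier G) \<Longrightarrow> face j x k \<in> carrier G"
  by (simp add: face_def)

lemma differential_hom:
  "group_hom (cochains G M n) (cochains G M (Suc n)) (differential G M act n)"
proof unfold_locales
  have "differential G M act n (\<phi> \<otimes>\<^bsub>cochains G M n\<^esub> \<psi>) =
      differential G M act n \<phi> \<otimes>\<^bsub>cochains G M (Suc n)\<^esub> differential G M act n \<psi>"
    if "\<phi> \<in> carrier (cochains G M n)" "\<psi> \<in> carrier (cochains G M n)" for \<phi> \<psi>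
  proof (rule cochain_eqI)
    fix x :: "nat \<Rightarrow> 'a" assume x: "\<And>k. x k \<in> carrier G"
    show "homogeneous G act (Suc n) (differential G M act n (\<phi> \<otimes>\<^bsub>cochains G M n\<^esub> \<psi>)) x =
        homogeneous G act (Suc n)
          (differential G M act n \<phi> \<otimes>\<^bsub>cochains G M (Suc n)\<^esub> differential G M act n \<psi>) x"
      using that x
      by (simp add: homogeneous_mult homogeneous_differential differential_closed face_closed
          homogeneous_closed M.int_pow_distrib Pi_iff del: atMost_Suc)
  qed (use that in \<open>simp_all add: differential_closed\<close>)
  then show "differential G M act n \<in> hom (cochains G M n) (cochains G M (Suc n))"
    by (simp add: hom_def differential_closed)
qed

sublocale d: group_hom "cochains G M n" "cochains G M (Suc n)" "differential G M act n" for n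
  by (rule differential_hom)

text \<open>
  By \<open>face_face\<close>, the terms of \<open>\<partial>\<partial>\<phi>\<close> obtained by forgetting first \<open>i\<close> and then \<open>j \<ge> i\<close>, or first \<open>j + 1\<close>
  and then \<open>i\<close>, carry the same value with opposite signs.
\<close>
lemma differential_differential:
  assumes \<phi>: "\<phi> \<in> carrier (cochains G M n)"
  shows "differential G M act (Suc n) (differential G M act n \<phi>) = \<one>\<^bsub>cochains G M (Suc (Suc n))\<^esub>"
proof (rule cochain_eqI)
  fix x :: "nat \<Rightarrow> 'a" assume x: "\<And>k. x k \<in> carrier G"
  interpret h: group_hom "cochains G M (Suc (Suc n))" M "\<lambda>\<phi>. homogeneous G act (Suc (Suc n)) \<phi> x"
    using x by (rule homogeneous_hom)
  define a where
    "a i j = homogeneous G act n \<phi> (face j (face i x)) [^]\<^bsub>M\<^esub> ((-1) ^ j * (-1) ^ i :: int)" for i j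
  have fc: "homogeneous G act n \<phi> (face j (face i x)) \<in> carrier M" for i j
    using \<phi> x by (simp add: homogeneous_closed face_closed)
  have "homogeneous G act (Suc (Suc n)) (differential G M act (Suc n) (differential G M act n \<phi>)) x
      = (\<Otimes>\<^bsub>M\<^esub>i\<in>{..Suc (Suc n)}.
          (\<Otimes>\<^bsub>M\<^esub>j\<in>{..Suc n}. homogeneous G act n \<phi> (face j (face i x)) [^]\<^bsub>M\<^esub> ((-1) ^ j :: int))
            [^]\<^bsub>M\<^esub> ((-1) ^ i :: int))"
    using \<phi> x by (simp add: homogeneous_differential face_closed del: atMost_Suc)
  also have "\<dots> = (\<Otimes>\<^bsub>M\<^esub>i\<in>{..Suc (Suc n)}. \<Otimes>\<^bsub>M\<^esub>j\<in>{..<Suc (Suc n)}. a i j)"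
    unfolding lessThan_Suc_atMost
  proof (intro M.finprod_cong' refl)
    fix i
    have "(\<Otimes>\<^bsub>M\<^esub>j\<in>{..Suc n}. homogeneous G act n \<phi> (face j (face i x)) [^]\<^bsub>M\<^esub> ((-1) ^ j :: int))
          [^]\<^bsub>M\<^esub> ((-1) ^ i :: int)
        = (\<Otimes>\<^bsub>M\<^esub>j\<in>{..Suc n}. (homogeneous G act n \<phi> (face j (face i x)) [^]\<^bsub>M\<^esub> ((-1) ^ j :: int))
          [^]\<^bsub>M\<^esub> ((-1) ^ i :: int))"
      using fc by (intro group_hom_finprod M.group_hom_int_pow M.comm_group_axioms) auto
    also have "\<dots> = (\<Otimes>\<^bsub>M\<^esub>j\<in>{..Suc n}. a i j)"
      using fc by (intro M.finprod_cong') (auto simp: a_def M.int_pow_pow)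
    finally show "(\<Otimes>\<^bsub>M\<^esub>j\<in>{..Suc n}. homogeneous G act n \<phi> (face j (face i x)) [^]\<^bsub>M\<^esub> ((-1) ^ j :: int))
          [^]\<^bsub>M\<^esub> ((-1) ^ i :: int) = (\<Otimes>\<^bsub>M\<^esub>j\<in>{..Suc n}. a i j)" .
  qed (use fc in \<open>auto simp: a_def intro!: M.finprod_closed\<close>)
  also have "\<dots> = \<one>\<^bsub>M\<^esub>"
    by (rule M.finprod_simplicial_cancel)
      (auto simp: a_def fc face_face M.int_pow_neg mult.commute)
  finally show "homogeneous G act (Suc (Suc n)) (differential G M act (Suc n) (differential G M act n \<phi>)) x
      = homogeneous G act (Suc (Suc n)) \<one>\<^bsub>cochains G M (Suc (Suc n))\<^esub> x"
    by simp
qed (use \<phi> in simp_all)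

text \<open>
  Swapping the vertices \<open>i - 1\<close> and \<open>i\<close> exchanges the two faces that forget one of them, and these have
  opposite signs in \<open>\<partial>\<phi>\<close>. Every other face of the swapped tuple is a swapped face, so there the
  alternation of \<open>\<phi>\<close> provides the sign.
\<close>
lemma differential_sym_cochains:
  assumes \<phi>: "\<phi> \<in> carrier (sym_cochains G M act n)"
  shows "differential G M act n \<phi> \<in> carrier (sym_cochains G M act (Suc n))"
  unfolding sym_cochains_iff_alternating
proof (intro conjI ballI allI impI)
  have K: "\<phi> \<in> carrier (cochains G M n)"
    using \<phi> by (rule sym_cochains_closed)
  then show "differential G M act n \<phi> \<in> carrier (cochains G M (Suc n))"
    by simp
  fix i and x :: "nat \<Rightarrow> 'a" assume i: "i \<in> {1..Suc n}" and x: "\<forall>k. x k \<in> carrier G"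
  define \<tau> where "\<tau> = transpose (i - 1) i"
  define p where "p y j = homogeneous G act n \<phi> (face j y) [^]\<^bsub>M\<^esub> ((-1) ^ j :: int)" for y j
  have hc: "homogeneous G act n \<phi> (face j x) \<in> carrier M" for j
    using K x by (simp add: homogeneous_closed face_closed)
  have alternating: "homogeneous G act n \<phi> (y \<circ> transpose (l - 1) l) = inv\<^bsub>M\<^esub> homogeneous G act n \<phi> y"
    if "l \<in> {1..n}" "\<forall>k. y k \<in> carrier G" for l y
    using \<phi> that unfolding sym_cochains_iff_alternating by blast
  have swap: "p (x \<circ> \<tau>) j = inv\<^bsub>M\<^esub> p x (\<tau> j)" if "j \<in> {..Suc n}" for j
  proof -
    consider "j = i" | "j = i - 1" | "j > i" | "j < i - 1" by linarith
    then show ?thesis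
    proof cases
      case 1
      obtain m where m: "i = Suc m" using i by (cases i) auto
      show ?thesis
        using 1 m hc face_transpose_at(1)[of i x] by (simp add: p_def \<tau>_def M.int_pow_neg)
    next
      case 2
      obtain m where m: "i = Suc m" using i by (cases i) auto
      show ?thesis
        using 2 m hc face_transpose_at(2)[of i x] by (simp add: p_def \<tau>_def M.int_pow_neg)
    next
      case 3
      then have "\<tau> j = j" "i \<in> {1..n}"
        using that i by (auto simp: \<tau>_def transpose_def)
      then show ?thesis
        using 3 x hc alternating[of i "face j x"] face_transpose_above[of i j x]
        by (simp add: p_def \<tau>_def face_closed M.int_pow_inv)
    next
      case 4
      then have "\<tau> j = j" "i - 1 \<in> {1..n}"
        using that i by (auto simp: \<tau>_def transpose_def)
      then show ?thesis
        using 4 x hc alternating[of "i - 1" "face j x"] face_transpose_below[of j i x]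
        by (simp add: p_def \<tau>_def face_closed M.int_pow_inv)
    qed
  qed
  have \<tau>: "\<tau> ` {..Suc n} = {..Suc n}" "inj_on \<tau> {..Suc n}"
    using i by (auto simp: \<tau>_def intro!: transpose_image_eq)
  have pc: "p x j \<in> carrier M" for j
    using hc by (simp add: p_def)
  have "homogeneous G act (Suc n) (differential G M act n \<phi>) (x \<circ> \<tau>) = (\<Otimes>\<^bsub>M\<^esub>j\<in>{..Suc n}. p (x \<circ> \<tau>) j)"
    using K x by (simp add: homogeneous_differential p_def del: atMost_Suc)
  also have "\<dots> = (\<Otimes>\<^bsub>M\<^esub>j\<in>{..Suc n}. inv\<^bsub>M\<^esub> p x (\<tau> j))"
    using pc swap by (intro M.finprod_cong') auto
  also have "\<dots> = inv\<^bsub>M\<^esub> (\<Otimes>\<^bsub>M\<^esub>j\<in>{..Suc n}. p x (\<tau> j))"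
    using pc by (intro group_hom_finprod[symmetric] M.group_hom_inv M.comm_group_axioms) auto
  also have "(\<Otimes>\<^bsub>M\<^esub>j\<in>{..Suc n}. p x (\<tau> j)) = (\<Otimes>\<^bsub>M\<^esub>j\<in>{..Suc n}. p x j)"
    using M.finprod_reindex[of "p x" \<tau> "{..Suc n}"] pc \<tau> by auto
  also have "\<dots> = homogeneous G act (Suc n) (differential G M act n \<phi>) x"
    using K x by (simp add: homogeneous_differential p_def del: atMost_Suc)
  finally show "homogeneous G act (Suc n) (differential G M act n \<phi>) (x \<circ> transpose (i - 1) i)
      = inv\<^bsub>M\<^esub> homogeneous G act (Suc n) (differential G M act n \<phi>) x"
    by (simp only: \<tau>_def)
qed

section \<open>Symmetric cohomology groups\<close>

lemma sym_cocycles_iff: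
  "\<phi> \<in> sym_cocycles G M act n \<longleftrightarrow>
     \<phi> \<in> carrier (sym_cochains G M act n) \<and> differential G M act n \<phi> = \<one>\<^bsub>cochains G M (Suc n)\<^esub>"
  by (auto simp: sym_cocycles_def kernel_def sym_cochains_closed)

lemma sym_cocycles_closed: "\<phi> \<in> sym_cocycles G M act n \<Longrightarrow> \<phi> \<in> carrier (cochains G M n)"
  by (simp add: sym_cocycles_iff sym_cochains_closed)

lemma sym_cocycles_subgroup: "subgroup (sym_cocycles G M act n) (cochains G M n)"
  unfolding sym_cocycles_def
  by (intro K.subgroups_Inter_pair d.subgroup_kernel sym_cochains_subgroup)

lemma sym_coboundaries_subgroup: "subgroup (sym_coboundaries G M act n) (cochains G M n)"
proof (cases n)
  case (Suc m)
  then show ?thesis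
    using d.subgroup_img_is_subgroup[OF sym_cochains_subgroup] by simp
qed (simp add: K.triv_subgroup)

lemma sym_coboundaries_subset: "sym_coboundaries G M act n \<subseteq> sym_cocycles G M act n"
proof (cases n)
  case (Suc m)
  then show ?thesis
    by (auto simp: sym_cocycles_iff differential_sym_cochains differential_differential sym_cochains_closed)
qed (use subgroup.one_closed[OF sym_cocycles_subgroup] in simp)

lemma comm_group_HS: "comm_group (HS G M act n)"
proof -
  let ?Z = "cochains G M n\<lparr>carrier := sym_cocycles G M act n\<rparr>"
  have "comm_group ?Z"
    using K.subgroup_imp_group[OF sym_cocycles_subgroup] subgroup.subset[OF sym_cocycles_subgroup]
    by (intro group.group_comm_groupI) (auto intro: K.m_comm)
  moreover have "subgroup (sym_coboundaries G M act n) ?Z"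
    by (intro K.subgroup_incl sym_coboundaries_subgroup sym_cocycles_subgroup sym_coboundaries_subset)
  ultimately show ?thesis
    unfolding HS_def by (rule comm_group.abelian_FactGroup)
qed

lemma carrier_HS: "carrier (HS G M act n) = sym_class G M act n ` sym_cocycles G M act n"
  by (simp add: HS_def carrier_FactGroup sym_class_def)

lemma one_HS: "\<one>\<^bsub>HS G M act n\<^esub> = sym_coboundaries G M act n"
  by (simp add: HS_def)

lemma sym_class_mult:
  assumes "\<phi> \<in> sym_cocycles G M act n" "\<psi> \<in> sym_cocycles G M act n"
  shows "sym_class G M act n (\<phi> \<otimes>\<^bsub>cochains G M n\<^esub> \<psi>)
    = sym_class G M act n \<phi> \<otimes>\<^bsub>HS G M act n\<^esub> sym_class G M act n \<psi>"
  using normal.rcos_sum[OF K.subgroup_imp_normal[OF sym_coboundaries_subgroup]]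
    assms[THEN subgroup.mem_carrier[OF sym_cocycles_subgroup]]
  by (simp add: HS_def sym_class_def)

lemma sym_class_eq_iff:
  assumes "\<phi> \<in> sym_cocycles G M act n" "\<psi> \<in> sym_cocycles G M act n"
  shows "sym_class G M act n \<phi> = sym_class G M act n \<psi>
    \<longleftrightarrow> \<phi> \<otimes>\<^bsub>cochains G M n\<^esub> inv\<^bsub>cochains G M n\<^esub> \<psi> \<in> sym_coboundaries G M act n"
proof -
  have c: "\<phi> \<in> carrier (cochains G M n)" "\<psi> \<in> carrier (cochains G M n)"
    using assms subgroup.subset[OF sym_cocycles_subgroup] by blast+
  have "sym_class G M act n \<phi> = sym_class G M act n \<psi> \<longleftrightarrow> \<phi> \<in> sym_class G M act n \<psi>"
    unfolding sym_class_def
    using K.repr_independence[OF _ c(2) sym_coboundaries_subgroup]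
      K.rcos_self[OF c(1) sym_coboundaries_subgroup] by blast
  then show ?thesis
    unfolding sym_class_def
    using subgroup.rcos_module[OF sym_coboundaries_subgroup K.group_axioms c(2,1)] by simp
qed

lemma sym_class_eq_one_iff:
  assumes "\<phi> \<in> sym_cocycles G M act n"
  shows "sym_class G M act n \<phi> = \<one>\<^bsub>HS G M act n\<^esub> \<longleftrightarrow> \<phi> \<in> sym_coboundaries G M act n"
proof -
  have c: "\<phi> \<in> carrier (cochains G M n)"
    using assms subgroup.subset[OF sym_cocycles_subgroup] by blast
  then show ?thesis
    unfolding one_HS sym_class_def
    using K.coset_join2[OF c sym_coboundaries_subgroup] K.rcos_self[OF c sym_coboundaries_subgroup]
    by auto
qed

lemma sym_class_memD:
  assumes "\<phi> \<in> sym_cocycles G M act n" "\<psi> \<in> sym_class G M act n \<phi>"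
  shows "\<psi> \<in> sym_cocycles G M act n"
    and "\<psi> \<otimes>\<^bsub>cochains G M n\<^esub> inv\<^bsub>cochains G M n\<^esub> \<phi> \<in> sym_coboundaries G M act n"
proof -
  show "\<psi> \<in> sym_cocycles G M act n"
    using assms sym_coboundaries_subset subgroup.m_closed[OF sym_cocycles_subgroup]
    by (fastforce simp: sym_class_def r_coset_def)
  show "\<psi> \<otimes>\<^bsub>cochains G M n\<^esub> inv\<^bsub>cochains G M n\<^esub> \<phi> \<in> sym_coboundaries G M act n"
    using assms(2) sym_cocycles_closed[OF assms(1)] unfolding sym_class_def
    by (intro subgroup.rcos_module_imp[OF sym_coboundaries_subgroup K.group_axioms])
qed

lemma sym_class_self: "\<phi> \<in> sym_cocycles G M act n \<Longrightarrow> \<phi> \<in> sym_class G M act n \<phi>"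
  unfolding sym_class_def
  using K.rcos_self[OF _ sym_coboundaries_subgroup] subgroup.subset[OF sym_cocycles_subgroup] by blast

end


section \<open>Maps of coefficient modules\<close>

lemma push_apply: "gs \<in> tuples G n \<Longrightarrow> push G n f \<phi> gs = f (\<phi> gs)"
  by (simp add: push_def compose_eq)

text \<open>
  Symmetry of a cochain involves only the action and inversion, so maps that respect these two preserve
  it. This treats the section \<open>s\<close> together with the homomorphisms \<open>\<iota>\<close> and \<open>\<pi>\<close>.
\<close>
locale G_module_odd_map = M: G_module G M actM + N: G_module G N actN
  for G (structure) and M and actM and N and actN +
  fixes f
  assumes closed: "f \<in> carrier M \<rightarrow> carrier N"
    and equivariant: "equivariant G M actM actN f"
    and odd: "a \<in> carrier M \<Longrightarrow> f (inv\<^bsub>M\<^esub> a) = inv\<^bsub>N\<^esub> f a"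
begin

lemma push_closed: "\<phi> \<in> carrier (cochains G M n) \<Longrightarrow> push G n f \<phi> \<in> carrier (cochains G N n)"
  using closed by (auto simp: cochains_def push_def compose_def PiE_iff Pi_iff)

lemma homogeneous_push:
  assumes "\<phi> \<in> carrier (cochains G M n)" "\<And>k. x k \<in> carrier G"
  shows "homogeneous G actN n (push G n f \<phi>) x = f (homogeneous G actM n \<phi> x)"
proof -
  have "steps G n x \<in> tuples G n"
    using assms(2) by (rule M.G.steps_in_tuples)
  then show ?thesis
    using assms equivariant M.cochain_closed
    by (simp add: homogeneous_def push_apply equivariant_def)
qed

lemma push_sym_cochains:
  "\<phi> \<in> carrier (sym_cochains G M actM n) \<Longrightarrow> push G n f \<phi> \<in> carrier (sym_cochains G N actN n)"
  unfolding M.sym_cochains_iff_alternating N.sym_cochains_iff_alternating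
  by (simp add: push_closed homogeneous_push odd M.homogeneous_closed)

lemma push_sym_cochains_iff:
  assumes inj: "inj_on f (carrier M)" and \<phi>: "\<phi> \<in> carrier (cochains G M n)"
  shows "push G n f \<phi> \<in> carrier (sym_cochains G N actN n) \<longleftrightarrow> \<phi> \<in> carrier (sym_cochains G M actM n)"
proof
  assume *: "push G n f \<phi> \<in> carrier (sym_cochains G N actN n)"
  have "homogeneous G actM n \<phi> (x \<circ> transpose (i - 1) i) = inv\<^bsub>M\<^esub> homogeneous G actM n \<phi> x"
    if "i \<in> {1..n}" "\<forall>k. x k \<in> carrier G" for i x
  proof -
    have "f (homogeneous G actM n \<phi> (x \<circ> transpose (i - 1) i)) = inv\<^bsub>N\<^esub> f (homogeneous G actM n \<phi> x)"
      using * that \<phi> homogeneous_push[OF \<phi>, of x] homogeneous_push[OF \<phi>, of "x \<circ> transpose (i - 1) i"]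
      unfolding N.sym_cochains_iff_alternating by simp
    also have "\<dots> = f (inv\<^bsub>M\<^esub> homogeneous G actM n \<phi> x)"
      using that \<phi> by (simp add: odd M.homogeneous_closed)
    finally show ?thesis
      using inj that \<phi> by (simp add: inj_on_eq_iff M.homogeneous_closed)
  qed
  then show "\<phi> \<in> carrier (sym_cochains G M actM n)"
    unfolding M.sym_cochains_iff_alternating using \<phi> by blast
qed (rule push_sym_cochains)

end

locale G_module_hom = M: G_module G M actM + N: G_module G N actN
  for G (structure) and M and actM and N and actN +
  fixes f
  assumes hom: "f \<in> hom M N"
    and equivariant: "equivariant G M actM actN f"
begin

sublocale f: group_hom M N f
  by unfold_locales (rule hom)

sublocale G_module_odd_map G M actM N actN f
  by unfold_locales (use equivariant in auto)

sublocale push: group_hom "cochains G M n" "cochains G N n" "push G n f" for n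
proof unfold_locales
  have "push G n f (\<phi> \<otimes>\<^bsub>cochains G M n\<^esub> \<psi>) = push G n f \<phi> \<otimes>\<^bsub>cochains G N n\<^esub> push G n f \<psi>"
    if "\<phi> \<in> carrier (cochains G M n)" "\<psi> \<in> carrier (cochains G M n)" for \<phi> \<psi>
    using that M.cochain_closed[OF that(1)] M.cochain_closed[OF that(2)]
    by (auto simp: cochains_def push_def compose_def fun_eq_iff)
  then show "push G n f \<in> hom (cochains G M n) (cochains G N n)"
    by (simp add: hom_def push_closed)
qed

lemma push_differential:
  assumes \<phi>: "\<phi> \<in> carrier (cochains G M n)"
  shows "push G (Suc n) f (differential G M actM n \<phi>) = differential G N actN n (push G n f \<phi>)"
proof (rule N.cochain_eqI)
  fix x :: "nat \<Rightarrow> 'a" assume x: "\<And>k. x k \<in> carrier G"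
  have "(\<lambda>j. homogeneous G actM n \<phi> (face j x) [^]\<^bsub>M\<^esub> ((-1) ^ j :: int)) \<in> {..Suc n} \<rightarrow> carrier M"
    using \<phi> x by (simp add: M.homogeneous_closed M.face_closed)
  from group_hom_finprod[OF f.group_hom_axioms M.M.comm_group_axioms N.M.comm_group_axioms this]
  show "homogeneous G actN (Suc n) (push G (Suc n) f (differential G M actM n \<phi>)) x
      = homogeneous G actN (Suc n) (differential G N actN n (push G n f \<phi>)) x"
    using \<phi> x
    by (simp add: homogeneous_push M.homogeneous_differential N.homogeneous_differential
        M.homogeneous_closed M.face_closed f.hom_int_pow del: atMost_Suc)
qed (use \<phi> in simp_all)

lemma push_sym_cocycles:
  "\<phi> \<in> sym_cocycles G M actM n \<Longrightarrow> push G n f \<phi> \<in> sym_cocycles G N actN n"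
  by (simp add: M.sym_cocycles_iff N.sym_cocycles_iff push_sym_cochains
      push_differential[symmetric] M.sym_cochains_closed)

lemma push_sym_coboundaries:
  "\<phi> \<in> sym_coboundaries G M actM n \<Longrightarrow> push G n f \<phi> \<in> sym_coboundaries G N actN n"
  by (cases n) (auto simp: push_differential push_sym_cochains M.sym_cochains_closed)

text \<open>
  The union defining \<open>HS_map\<close> is over cosets that all agree, because \<open>f\<close> maps coboundaries to coboundaries.
\<close>
lemma HS_map_sym_class:
  assumes \<phi>: "\<phi> \<in> sym_cocycles G M actM n"
  shows "HS_map G N actN n f (sym_class G M actM n \<phi>) = sym_class G N actN n (push G n f \<phi>)"
proof -
  have "sym_class G N actN n (push G n f \<phi>') = sym_class G N actN n (push G n f \<phi>)"
    if \<phi>': "\<phi>' \<in> sym_class G M actM n \<phi>" for \<phi>'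
  proof -
    have diff: "\<phi>' \<otimes>\<^bsub>cochains G M n\<^esub> inv\<^bsub>cochains G M n\<^esub> \<phi> \<in> sym_coboundaries G M actM n"
      and Z: "\<phi>' \<in> sym_cocycles G M actM n"
      using M.sym_class_memD[OF \<phi> \<phi>'] by auto
    have "push G n f (\<phi>' \<otimes>\<^bsub>cochains G M n\<^esub> inv\<^bsub>cochains G M n\<^esub> \<phi>) \<in> sym_coboundaries G N actN n"
      using diff by (rule push_sym_coboundaries)
    then show ?thesis
      using Z \<phi> by (simp add: N.sym_class_eq_iff push_sym_cocycles M.sym_cocycles_closed)
  qed
  then show ?thesis
    using M.sym_class_self[OF \<phi>] unfolding HS_map_def by blast
qed

end

section \<open>Exactness of the sequence of symmetric complexes\<close>

locale symmetric_extension =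
  A: G_module G A actA + B: G_module G B actB + C: G_module G C actC +
  \<iota>: G_module_hom G A actA B actB \<iota> + \<pi>: G_module_hom G B actB C actC \<pi> +
  s: G_module_odd_map G C actC B actB s
  for G (structure) and A and actA and B and actB and C and actC and \<iota> and \<pi> and s +
  assumes exact: "short_exact A B C \<iota> \<pi>"
    and s_section: "c \<in> carrier C \<Longrightarrow> \<pi> (s c) = c"
begin

lemma inj_\<iota>: "inj_on \<iota> (carrier A)"
  and kernel_\<pi>: "kernel B C \<pi> = \<iota> ` carrier A"
  using exact by (auto simp: short_exact_def mon_def)

lemma push_\<pi>_push_s:
  assumes "\<phi> \<in> carrier (cochains G C n)"
  shows "push G n \<pi> (push G n s \<phi>) = \<phi>"
proof (rule PiE_ext)
  show "push G n \<pi> (push G n s \<phi>) \<in> tuples G n \<rightarrow>\<^sub>E carrier C" "\<phi> \<in> tuples G n \<rightarrow>\<^sub>E carrier C"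
    using s.push_closed[OF assms] \<pi>.push_closed assms by (auto simp: cochains_def)
qed (use assms C.cochain_closed in \<open>simp add: push_apply s_section\<close>)

lemma push_\<pi>_push_\<iota>:
  assumes "\<chi> \<in> carrier (cochains G A n)"
  shows "push G n \<pi> (push G n \<iota> \<chi>) = \<one>\<^bsub>cochains G C n\<^esub>"
proof (rule PiE_ext)
  show "push G n \<pi> (push G n \<iota> \<chi>) \<in> tuples G n \<rightarrow>\<^sub>E carrier C"
    "\<one>\<^bsub>cochains G C n\<^esub> \<in> tuples G n \<rightarrow>\<^sub>E carrier C"
    using \<pi>.push_closed[OF \<iota>.push_closed[OF assms]] C.K.one_closed[of n] by (simp_all only: cochains_def carrier_product_group)
  fix gs assume gs: "gs \<in> tuples G n"
  then have "\<iota> (\<chi> gs) \<in> kernel B C \<pi>"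
    using assms A.cochain_closed kernel_\<pi> by blast
  then show "push G n \<pi> (push G n \<iota> \<chi>) gs = \<one>\<^bsub>cochains G C n\<^esub> gs"
    using gs by (simp add: push_apply kernel_def) (simp add: cochains_def)
qed

lemma push_\<iota>_inject:
  assumes "\<chi> \<in> carrier (cochains G A n)" "\<chi>' \<in> carrier (cochains G A n)"
    and "push G n \<iota> \<chi> = push G n \<iota> \<chi>'"
  shows "\<chi> = \<chi>'"
proof (rule PiE_ext)
  show "\<chi> \<in> tuples G n \<rightarrow>\<^sub>E carrier A" "\<chi>' \<in> tuples G n \<rightarrow>\<^sub>E carrier A"
    using assms by (auto simp: cochains_def)
  fix gs assume gs: "gs \<in> tuples G n"
  then have "\<iota> (\<chi> gs) = \<iota> (\<chi>' gs)"
    using fun_cong[OF assms(3), of gs] by (simp add: push_apply)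
  then show "\<chi> gs = \<chi>' gs"
    using inj_\<iota> gs assms A.cochain_closed by (auto dest: inj_onD)
qed

text \<open>
  A cochain with values in \<open>ker \<pi>\<close> is pulled back along \<open>\<iota>\<close> pointwise; injectivity and equivariance of
  \<open>\<iota>\<close> carry symmetry back to the result.
\<close>
lemma retract:
  assumes \<psi>: "\<psi> \<in> carrier (sym_cochains G B actB n)" and ker: "push G n \<pi> \<psi> = \<one>\<^bsub>cochains G C n\<^esub>"
  shows "push G n (inv_into (carrier A) \<iota>) \<psi> \<in> carrier (sym_cochains G A actA n)"
    and "push G n \<iota> (push G n (inv_into (carrier A) \<iota>) \<psi>) = \<psi>"
proof -
  let ?\<chi> = "push G n (inv_into (carrier A) \<iota>) \<psi>"
  have K: "\<psi> \<in> carrier (cochains G B n)"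
    using \<psi> by (rule B.sym_cochains_closed)
  have image: "\<psi> gs \<in> \<iota> ` carrier A" if "gs \<in> tuples G n" for gs
  proof -
    have "\<pi> (\<psi> gs) = \<one>\<^bsub>C\<^esub>"
      using fun_cong[OF ker, of gs] that by (simp add: push_apply) (simp add: cochains_def)
    then show ?thesis
      using B.cochain_closed[OF K that] by (simp add: kernel_def flip: kernel_\<pi>)
  qed
  have \<chi>: "?\<chi> \<in> carrier (cochains G A n)"
    using image by (auto simp: cochains_def push_def compose_def inv_into_into)
  show eq: "push G n \<iota> ?\<chi> = \<psi>"
  proof (rule PiE_ext)
    show "push G n \<iota> ?\<chi> \<in> tuples G n \<rightarrow>\<^sub>E carrier B" "\<psi> \<in> tuples G n \<rightarrow>\<^sub>E carrier B"
      using \<iota>.push_closed[OF \<chi>] K by (auto simp: cochains_def)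
  qed (use image in \<open>simp add: push_apply f_inv_into_f\<close>)
  show "?\<chi> \<in> carrier (sym_cochains G A actA n)"
    using \<psi> \<iota>.push_sym_cochains_iff[OF inj_\<iota> \<chi>] eq by simp
qed

text \<open>
  Surjectivity of \<open>CS\<^sup>n(G,B) \<rightarrow> CS\<^sup>n(G,C)\<close> is the point where the section enters: taking invariants is only left
  exact in general, but \<open>s \<circ> \<phi>\<close> is a symmetric lift of a symmetric \<open>\<phi>\<close>.
\<close>
lemma short_exact_sym_cochains:
  "short_exact (sym_cochains G A actA n) (sym_cochains G B actB n) (sym_cochains G C actC n)
     (push G n \<iota>) (push G n \<pi>)"
  unfolding short_exact_def
proof (intro conjI)
  have mult: "x \<otimes>\<^bsub>sym_cochains G M act n\<^esub> y = x \<otimes>\<^bsub>cochains G M n\<^esub> y"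
    and one: "\<one>\<^bsub>sym_cochains G M act n\<^esub> = \<one>\<^bsub>cochains G M n\<^esub>" for M :: "('m, 'y) monoid_scheme" and act x y
    by (simp_all add: sym_cochains_def)
  show "push G n \<iota> \<in> mon (sym_cochains G A actA n) (sym_cochains G B actB n)"
    by (auto simp: mon_def hom_def mult \<iota>.push_sym_cochains A.sym_cochains_closed
        intro!: inj_onI push_\<iota>_inject)
  have "\<phi> \<in> push G n \<pi> ` carrier (sym_cochains G B actB n)" if "\<phi> \<in> carrier (sym_cochains G C actC n)" for \<phi>
    using that push_\<pi>_push_s s.push_sym_cochains C.sym_cochains_closed by (metis image_eqI)
  then show "push G n \<pi> \<in> epi (sym_cochains G B actB n) (sym_cochains G C actC n)"
    by (auto simp: epi_def hom_def mult \<pi>.push_sym_cochains B.sym_cochains_closed)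
  show "kernel (sym_cochains G B actB n) (sym_cochains G C actC n) (push G n \<pi>)
      = push G n \<iota> ` carrier (sym_cochains G A actA n)"
  proof (intro equalityI subsetI)
    fix \<psi> assume "\<psi> \<in> kernel (sym_cochains G B actB n) (sym_cochains G C actC n) (push G n \<pi>)"
    then show "\<psi> \<in> push G n \<iota> ` carrier (sym_cochains G A actA n)"
      using retract[of \<psi> n] by (auto simp: kernel_def one intro: rev_image_eqI)
  qed (auto simp: kernel_def one \<iota>.push_sym_cochains push_\<pi>_push_\<iota> A.sym_cochains_closed)
qed

lemma short_exact_sym_complexes: "short_exact_sym_complexes G A actA B actB C actC \<iota> \<pi>"
  unfolding short_exact_sym_complexes_def
  using short_exact_sym_cochains \<iota>.push_differential \<pi>.push_differential
    A.sym_cochains_closed B.sym_cochains_closed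
  by blast

text \<open>
  For \<open>n > 0\<close>, a symmetric \<open>\<theta>\<close> with \<open>\<phi> = \<partial>\<theta>\<close> has the symmetric lift \<open>s \<circ> \<theta>\<close>, and \<open>\<partial>(s \<circ> \<theta>)\<close> lifts \<open>\<phi>\<close>.
\<close>
lemma sym_coboundary_lift:
  assumes "\<phi> \<in> sym_coboundaries G C actC n"
  obtains \<psi> where "\<psi> \<in> sym_coboundaries G B actB n" "push G n \<pi> \<psi> = \<phi>"
proof (cases n)
  case 0
  then show ?thesis
    using assms that[of "\<one>\<^bsub>cochains G B n\<^esub>"] by simp
next
  case (Suc m)
  then obtain \<theta> where \<theta>: "\<theta> \<in> carrier (sym_cochains G C actC m)" "\<phi> = differential G C actC m \<theta>"
    using assms by auto
  then have "push G n \<pi> (differential G B actB m (push G m s \<theta>)) = \<phi>"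
    using Suc by (simp add: \<pi>.push_differential s.push_closed push_\<pi>_push_s C.sym_cochains_closed)
  then show ?thesis
    using that Suc \<theta>(1) s.push_sym_cochains by force
qed

section \<open>The connecting homomorphism\<close>

text \<open>
  The data of the snake lemma on cochains: \<open>\<psi>\<close> lifts the cocycle \<open>\<phi>\<close> and \<open>\<chi>\<close> is \<open>\<partial>\<psi>\<close> seen in \<open>A\<close>. The
  lift is arbitrary, so that zigzags are closed under multiplication and inversion even though \<open>s\<close> need not be
  a homomorphism.
\<close>
definition zigzag where
  "zigzag n \<phi> \<psi> \<chi> \<longleftrightarrow>
     \<phi> \<in> sym_cocycles G C actC n \<and> \<psi> \<in> carrier (sym_cochains G B actB n) \<and>
     \<chi> \<in> carrier (sym_cochains G A actA (Suc n)) \<and>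
     push G n \<pi> \<psi> = \<phi> \<and> push G (Suc n) \<iota> \<chi> = differential G B actB n \<psi>"

lemma snake_iff_zigzag:
  "snake G A actA B actB C actC \<iota> \<pi> n X Y \<longleftrightarrow>
     (\<exists>\<phi> \<psi> \<chi>. zigzag n \<phi> \<psi> \<chi> \<and> X = sym_class G C actC n \<phi> \<and> Y = sym_class G A actA (Suc n) \<chi>)"
  unfolding snake_def zigzag_def by blast

lemma zigzag_cocycle:
  assumes "zigzag n \<phi> \<psi> \<chi>"
  shows "\<chi> \<in> sym_cocycles G A actA (Suc n)"
proof -
  have \<chi>: "\<chi> \<in> carrier (sym_cochains G A actA (Suc n))" "\<chi> \<in> carrier (cochains G A (Suc n))"
    and \<psi>: "\<psi> \<in> carrier (cochains G B n)"
    using assms A.sym_cochains_closed B.sym_cochains_closed by (auto simp: zigzag_def)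
  have "push G (Suc (Suc n)) \<iota> (differential G A actA (Suc n) \<chi>)
      = push G (Suc (Suc n)) \<iota> \<one>\<^bsub>cochains G A (Suc (Suc n))\<^esub>"
    using assms \<chi> \<psi> by (simp add: \<iota>.push_differential zigzag_def B.differential_differential)
  then have "differential G A actA (Suc n) \<chi> = \<one>\<^bsub>cochains G A (Suc (Suc n))\<^esub>"
    using \<chi> by (intro push_\<iota>_inject[where n = "Suc (Suc n)"]) simp_all
  with \<chi> show ?thesis by (simp add: A.sym_cocycles_iff)
qed

text \<open>
  As \<open>s \<circ> \<phi>\<close> is one of the symmetric lifts of \<open>\<phi>\<close>, the formula for \<open>\<beta>\<close> is an instance of the snake
  construction.
\<close>
lemma zigzag_beta:
  assumes \<phi>: "\<phi> \<in> sym_cocycles G C actC n"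
  shows "zigzag n \<phi> (push G n s \<phi>) (beta_cochain G A B actB \<iota> s n \<phi>)"
proof -
  have \<psi>: "push G n s \<phi> \<in> carrier (sym_cochains G B actB n)"
    and lift: "push G n \<pi> (push G n s \<phi>) = \<phi>"
    using \<phi> by (simp_all add: C.sym_cocycles_iff s.push_sym_cochains push_\<pi>_push_s C.sym_cochains_closed)
  have "push G (Suc n) \<pi> (differential G B actB n (push G n s \<phi>)) = \<one>\<^bsub>cochains G C (Suc n)\<^esub>"
    using \<phi> \<psi> lift by (simp add: \<pi>.push_differential B.sym_cochains_closed C.sym_cocycles_iff)
  from retract[OF B.differential_sym_cochains[OF \<psi>] this]
  show ?thesis
    using \<phi> \<psi> lift by (simp add: zigzag_def beta_cochain_def)
qed

lemma zigzag_mult: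
  assumes "zigzag n \<phi> \<psi> \<chi>" "zigzag n \<phi>' \<psi>' \<chi>'"
  shows "zigzag n (\<phi> \<otimes>\<^bsub>cochains G C n\<^esub> \<phi>') (\<psi> \<otimes>\<^bsub>cochains G B n\<^esub> \<psi>') (\<chi> \<otimes>\<^bsub>cochains G A (Suc n)\<^esub> \<chi>')"
  using assms A.sym_cochains_closed B.sym_cochains_closed subgroup.m_closed[OF C.sym_cocycles_subgroup]
    subgroup.m_closed[OF B.sym_cochains_subgroup] subgroup.m_closed[OF A.sym_cochains_subgroup]
  by (simp add: zigzag_def)

lemma zigzag_inv:
  assumes "zigzag n \<phi> \<psi> \<chi>"
  shows "zigzag n (inv\<^bsub>cochains G C n\<^esub> \<phi>) (inv\<^bsub>cochains G B n\<^esub> \<psi>) (inv\<^bsub>cochains G A (Suc n)\<^esub> \<chi>)"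
  using assms A.sym_cochains_closed B.sym_cochains_closed subgroup.m_inv_closed[OF C.sym_cocycles_subgroup]
    subgroup.m_inv_closed[OF B.sym_cochains_subgroup] subgroup.m_inv_closed[OF A.sym_cochains_subgroup]
  by (simp add: zigzag_def)

text \<open>
  Let \<open>\<psi>\<^sub>0\<close> be a coboundary that lifts the coboundary \<open>\<phi>\<close>. Then \<open>\<psi> - \<psi>\<^sub>0\<close> comes from some \<open>\<theta>\<close> in
  \<open>CS\<^sup>n(G,A)\<close>, and \<open>\<partial>\<psi> = \<partial>(\<psi> - \<psi>\<^sub>0)\<close> shows \<open>\<chi> = \<partial>\<theta>\<close>.
\<close>
lemma zigzag_coboundary:
  assumes z: "zigzag n \<phi> \<psi> \<chi>" and \<phi>: "\<phi> \<in> sym_coboundaries G C actC n"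
  shows "\<chi> \<in> sym_coboundaries G A actA (Suc n)"
proof -
  obtain \<psi>\<^sub>0 where \<psi>\<^sub>0: "\<psi>\<^sub>0 \<in> sym_coboundaries G B actB n" "push G n \<pi> \<psi>\<^sub>0 = \<phi>"
    using \<phi> by (rule sym_coboundary_lift)
  have cocycle: "\<psi>\<^sub>0 \<in> carrier (sym_cochains G B actB n)" "differential G B actB n \<psi>\<^sub>0 = \<one>\<^bsub>cochains G B (Suc n)\<^esub>"
    using subsetD[OF B.sym_coboundaries_subset \<psi>\<^sub>0(1)] by (simp_all add: B.sym_cocycles_iff)
  have \<psi>: "\<psi> \<in> carrier (sym_cochains G B actB n)"
    using z by (simp add: zigzag_def)
  have K: "\<psi> \<in> carrier (cochains G B n)" "\<psi>\<^sub>0 \<in> carrier (cochains G B n)"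
    using \<psi> cocycle B.sym_cochains_closed by blast+
  let ?\<psi> = "\<psi> \<otimes>\<^bsub>cochains G B n\<^esub> inv\<^bsub>cochains G B n\<^esub> \<psi>\<^sub>0"
  have \<psi>': "?\<psi> \<in> carrier (sym_cochains G B actB n)"
    using \<psi> cocycle by (intro subgroup.m_closed[OF B.sym_cochains_subgroup]
        subgroup.m_inv_closed[OF B.sym_cochains_subgroup])
  have "\<phi> \<in> carrier (cochains G C n)"
    using z C.sym_cocycles_closed by (auto simp: zigzag_def)
  then have "push G n \<pi> ?\<psi> = \<one>\<^bsub>cochains G C n\<^esub>"
    using K \<psi>\<^sub>0 z by (simp add: zigzag_def)
  from retract[OF \<psi>' this] obtain \<theta> where
    \<theta>: "\<theta> \<in> carrier (sym_cochains G A actA n)" "push G n \<iota> \<theta> = ?\<psi>" by blast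
  have "push G (Suc n) \<iota> (differential G A actA n \<theta>) = push G (Suc n) \<iota> \<chi>"
    using \<theta> K cocycle z by (simp add: \<iota>.push_differential A.sym_cochains_closed zigzag_def)
  then have "differential G A actA n \<theta> = \<chi>"
    using \<theta> z by (intro push_\<iota>_inject[where n = "Suc n"]) (simp_all add: A.sym_cochains_closed zigzag_def)
  then show ?thesis
    using \<theta>(1) by auto
qed

text \<open>
  Zigzags form a group, so independence of the representative and of the lift both reduce to the case
  in which the class of \<open>\<phi>\<close> vanishes.
\<close>
lemma zigzag_class_eq:
  assumes z: "zigzag n \<phi> \<psi> \<chi>" "zigzag n \<phi>' \<psi>' \<chi>'"
    and eq: "sym_class G C actC n \<phi> = sym_class G C actC n \<phi>'"
  shows "sym_class G A actA (Suc n) \<chi> = sym_class G A actA (Suc n) \<chi>'"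
proof -
  have "\<phi> \<otimes>\<^bsub>cochains G C n\<^esub> inv\<^bsub>cochains G C n\<^esub> \<phi>' \<in> sym_coboundaries G C actC n"
    using z eq by (simp add: C.sym_class_eq_iff zigzag_def)
  then have "\<chi> \<otimes>\<^bsub>cochains G A (Suc n)\<^esub> inv\<^bsub>cochains G A (Suc n)\<^esub> \<chi>' \<in> sym_coboundaries G A actA (Suc n)"
    by (rule zigzag_coboundary[OF zigzag_mult[OF z(1) zigzag_inv[OF z(2)]]])
  then show ?thesis
    using z by (simp only: A.sym_class_eq_iff zigzag_cocycle)
qed

text \<open>
  The choice is only of a name for the value: the snake relation is single-valued by \<open>zigzag_class_eq\<close>.
\<close>
definition connecting where
  "connecting n X = (SOME Y. snake G A actA B actB C actC \<iota> \<pi> n X Y)"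

lemma snake_connecting:
  assumes X: "X \<in> carrier (HS G C actC n)"
  shows "connecting n X = Y \<longleftrightarrow> snake G A actA B actB C actC \<iota> \<pi> n X Y"
proof -
  obtain \<phi> where "\<phi> \<in> sym_cocycles G C actC n" "X = sym_class G C actC n \<phi>"
    using X by (auto simp: C.carrier_HS)
  then have "\<exists>Y. snake G A actA B actB C actC \<iota> \<pi> n X Y"
    using zigzag_beta snake_iff_zigzag by blast
  then have "snake G A actA B actB C actC \<iota> \<pi> n X (connecting n X)"
    unfolding connecting_def by (rule someI_ex)
  moreover have "Y = Y'"
    if "snake G A actA B actB C actC \<iota> \<pi> n X Y" "snake G A actA B actB C actC \<iota> \<pi> n X Y'" for Y Y'
    using that zigzag_class_eq unfolding snake_iff_zigzag by blast
  ultimately show ?thesis by blast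
qed

lemma connecting_zigzag:
  assumes "zigzag n \<phi> \<psi> \<chi>"
  shows "connecting n (sym_class G C actC n \<phi>) = sym_class G A actA (Suc n) \<chi>"
  using assms snake_connecting[of "sym_class G C actC n \<phi>" n] snake_iff_zigzag
  by (auto simp: C.carrier_HS zigzag_def)

lemma connecting_hom: "group_hom (HS G C actC n) (HS G A actA (Suc n)) (connecting n)"
proof -
  have "connecting n X \<in> carrier (HS G A actA (Suc n))" if X: "X \<in> carrier (HS G C actC n)" for X
    using X zigzag_beta connecting_zigzag zigzag_cocycle by (force simp: C.carrier_HS A.carrier_HS)
  moreover have "connecting n (X \<otimes>\<^bsub>HS G C actC n\<^esub> X') = connecting n X \<otimes>\<^bsub>HS G A actA (Suc n)\<^esub> connecting n X'"
    if X: "X \<in> carrier (HS G C actC n)" "X' \<in> carrier (HS G C actC n)" for X X'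
  proof -
    obtain \<phi> \<phi>' where \<phi>: "\<phi> \<in> sym_cocycles G C actC n" "\<phi>' \<in> sym_cocycles G C actC n"
        "X = sym_class G C actC n \<phi>" "X' = sym_class G C actC n \<phi>'"
      using X by (auto simp: C.carrier_HS)
    note z = zigzag_beta[OF \<phi>(1)] zigzag_beta[OF \<phi>(2)]
    show ?thesis
      using connecting_zigzag[OF zigzag_mult[OF z]] z[THEN connecting_zigzag] z[THEN zigzag_cocycle] \<phi>
      by (simp add: C.sym_class_mult A.sym_class_mult)
  qed
  ultimately show ?thesis
    using comm_group.axioms(2)[OF C.comm_group_HS] comm_group.axioms(2)[OF A.comm_group_HS]
    by (simp add: group_hom_def group_hom_axioms_def hom_def)
qed

section \<open>Exactness of the cohomology sequence\<close>

text \<open>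
  If \<open>\<pi> \<circ> \<psi>\<close> is a coboundary, subtracting from \<open>\<psi>\<close> a coboundary with the same image leaves a cocycle in
  the same class that takes values in \<open>ker \<pi>\<close>. As \<open>n\<close> is arbitrary, the lemma covers both terms with
  coefficients in \<open>B\<close>.
\<close>
lemma exact_at_B:
  "kernel (HS G B actB n) (HS G C actC n) (HS_map G C actC n \<pi>)
    = HS_map G B actB n \<iota> ` carrier (HS G A actA n)"
proof (intro equalityI subsetI)
  fix X assume X: "X \<in> kernel (HS G B actB n) (HS G C actC n) (HS_map G C actC n \<pi>)"
  then obtain \<psi> where \<psi>: "\<psi> \<in> sym_cocycles G B actB n" "X = sym_class G B actB n \<psi>"
    by (auto simp: kernel_def B.carrier_HS)
  have "push G n \<pi> \<psi> \<in> sym_coboundaries G C actC n"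
    using X \<psi> by (simp add: kernel_def \<pi>.HS_map_sym_class C.sym_class_eq_one_iff \<pi>.push_sym_cocycles)
  then obtain \<psi>\<^sub>0 where \<psi>\<^sub>0: "\<psi>\<^sub>0 \<in> sym_coboundaries G B actB n" "push G n \<pi> \<psi>\<^sub>0 = push G n \<pi> \<psi>"
    by (rule sym_coboundary_lift)
  let ?\<psi> = "\<psi> \<otimes>\<^bsub>cochains G B n\<^esub> inv\<^bsub>cochains G B n\<^esub> \<psi>\<^sub>0"
  have Z: "\<psi>\<^sub>0 \<in> sym_cocycles G B actB n"
    using \<psi>\<^sub>0(1) B.sym_coboundaries_subset by blast
  then have \<psi>': "?\<psi> \<in> sym_cocycles G B actB n"
    using \<psi>(1) by (intro subgroup.m_closed[OF B.sym_cocycles_subgroup]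
        subgroup.m_inv_closed[OF B.sym_cocycles_subgroup])
  have K: "\<psi> \<in> carrier (cochains G B n)" "\<psi>\<^sub>0 \<in> carrier (cochains G B n)"
    using \<psi>(1) Z B.sym_cocycles_closed by blast+
  have "push G n \<pi> ?\<psi> = \<one>\<^bsub>cochains G C n\<^esub>"
    using K \<psi>\<^sub>0(2) \<pi>.push_closed[OF K(1)] by simp
  with \<psi>' obtain \<chi> where \<chi>: "\<chi> \<in> carrier (sym_cochains G A actA n)" "push G n \<iota> \<chi> = ?\<psi>"
    using retract[of ?\<psi> n] by (auto simp: B.sym_cocycles_iff)
  have "\<chi> \<in> sym_cocycles G A actA n"
  proof -
    have "push G (Suc n) \<iota> (differential G A actA n \<chi>) = push G (Suc n) \<iota> \<one>\<^bsub>cochains G A (Suc n)\<^esub>"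
      using \<chi> \<psi>' by (simp add: \<iota>.push_differential A.sym_cochains_closed B.sym_cocycles_iff del: B.d.hom_mult)
    then have "differential G A actA n \<chi> = \<one>\<^bsub>cochains G A (Suc n)\<^esub>"
      using \<chi>(1) by (intro push_\<iota>_inject[where n = "Suc n"]) (simp_all add: A.sym_cochains_closed)
    then show ?thesis using \<chi>(1) by (simp add: A.sym_cocycles_iff)
  qed
  moreover have "X = sym_class G B actB n ?\<psi>"
  proof -
    have "\<psi> \<otimes>\<^bsub>cochains G B n\<^esub> inv\<^bsub>cochains G B n\<^esub> ?\<psi> = \<psi>\<^sub>0"
      using K by (simp add: B.K.inv_mult B.K.m_assoc[symmetric])
    then show ?thesis
      using \<psi> \<psi>' \<psi>\<^sub>0(1) by (simp add: B.sym_class_eq_iff)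
  qed
  ultimately show "X \<in> HS_map G B actB n \<iota> ` carrier (HS G A actA n)"
    using \<chi>(2) by (auto simp: A.carrier_HS \<iota>.HS_map_sym_class intro!: image_eqI)
next
  fix X assume "X \<in> HS_map G B actB n \<iota> ` carrier (HS G A actA n)"
  then obtain \<chi> where \<chi>: "\<chi> \<in> sym_cocycles G A actA n" "X = sym_class G B actB n (push G n \<iota> \<chi>)"
    by (auto simp: A.carrier_HS \<iota>.HS_map_sym_class)
  have "\<one>\<^bsub>cochains G C n\<^esub> \<in> sym_coboundaries G C actC n"
    by (rule subgroup.one_closed[OF C.sym_coboundaries_subgroup])
  then show "X \<in> kernel (HS G B actB n) (HS G C actC n) (HS_map G C actC n \<pi>)"
    using \<chi> push_\<pi>_push_\<iota>[OF A.sym_cocycles_closed[OF \<chi>(1)]] \<pi>.push_sym_cocycles[OF \<iota>.push_sym_cocycles[OF \<chi>(1)]]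
    by (simp add: kernel_def B.carrier_HS \<iota>.push_sym_cocycles \<pi>.HS_map_sym_class C.sym_class_eq_one_iff)
qed

text \<open>
  If \<open>\<chi> = \<partial>\<theta>\<close> in a zigzag over \<open>\<phi>\<close>, the lift \<open>\<psi> - \<iota> \<circ> \<theta>\<close> of \<open>\<phi>\<close> is a cocycle. Conversely a cocycle \<open>\<psi>\<close>
  is a lift of \<open>\<pi> \<circ> \<psi>\<close> with \<open>\<partial>\<psi> = 0\<close>.
\<close>
lemma exact_at_C:
  "kernel (HS G C actC n) (HS G A actA (Suc n)) (connecting n)
    = HS_map G C actC n \<pi> ` carrier (HS G B actB n)"
proof (intro equalityI subsetI)
  fix X assume X: "X \<in> kernel (HS G C actC n) (HS G A actA (Suc n)) (connecting n)"
  then obtain \<phi> where \<phi>: "\<phi> \<in> sym_cocycles G C actC n" "X = sym_class G C actC n \<phi>"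
    by (auto simp: kernel_def C.carrier_HS)
  define \<psi> where "\<psi> = push G n s \<phi>"
  obtain \<chi> where z: "zigzag n \<phi> \<psi> \<chi>"
    using zigzag_beta[OF \<phi>(1)] by (auto simp: \<psi>_def)
  have "\<chi> \<in> sym_coboundaries G A actA (Suc n)"
    using X \<phi>(2) by (simp add: kernel_def connecting_zigzag[OF z] A.sym_class_eq_one_iff[OF zigzag_cocycle[OF z]])
  then obtain \<theta> where \<theta>: "\<theta> \<in> carrier (sym_cochains G A actA n)" "\<chi> = differential G A actA n \<theta>"
    by auto
  let ?\<psi> = "\<psi> \<otimes>\<^bsub>cochains G B n\<^esub> inv\<^bsub>cochains G B n\<^esub> (push G n \<iota> \<theta>)"
  have \<psi>: "\<psi> \<in> carrier (sym_cochains G B actB n)" "\<psi> \<in> carrier (cochains G B n)"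
    "\<theta> \<in> carrier (cochains G A n)" "\<phi> \<in> carrier (cochains G C n)"
    using z \<theta> B.sym_cochains_closed A.sym_cochains_closed C.sym_cocycles_closed by (auto simp: zigzag_def)
  have "?\<psi> \<in> carrier (sym_cochains G B actB n)"
    using \<psi> \<theta> by (intro subgroup.m_closed[OF B.sym_cochains_subgroup]
        subgroup.m_inv_closed[OF B.sym_cochains_subgroup] \<iota>.push_sym_cochains)
  moreover have "differential G B actB n ?\<psi> = \<one>\<^bsub>cochains G B (Suc n)\<^esub>"
    using z \<psi> \<theta> by (simp add: zigzag_def \<iota>.push_differential)
  moreover have "push G n \<pi> ?\<psi> = \<phi>"
    using z \<psi> by (simp add: zigzag_def push_\<pi>_push_\<iota>)
  ultimately show "X \<in> HS_map G C actC n \<pi> ` carrier (HS G B actB n)"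
    using \<phi>(2) by (force simp: B.carrier_HS B.sym_cocycles_iff \<pi>.HS_map_sym_class)
next
  fix X assume "X \<in> HS_map G C actC n \<pi> ` carrier (HS G B actB n)"
  then obtain \<psi> where \<psi>: "\<psi> \<in> sym_cocycles G B actB n" "X = sym_class G C actC n (push G n \<pi> \<psi>)"
    by (auto simp: B.carrier_HS \<pi>.HS_map_sym_class)
  have "zigzag n (push G n \<pi> \<psi>) \<psi> \<one>\<^bsub>cochains G A (Suc n)\<^esub>"
    using \<psi>(1) \<pi>.push_sym_cocycles[OF \<psi>(1)] subgroup.one_closed[OF A.sym_cochains_subgroup]
    by (simp add: zigzag_def B.sym_cocycles_iff)
  from connecting_zigzag[OF this] A.sym_class_eq_one_iff[OF zigzag_cocycle[OF this]]
  show "X \<in> kernel (HS G C actC n) (HS G A actA (Suc n)) (connecting n)"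
    using \<psi> \<pi>.push_sym_cocycles[OF \<psi>(1)] subgroup.one_closed[OF A.sym_coboundaries_subgroup, of "Suc n"]
    by (simp add: kernel_def C.carrier_HS del: sym_coboundaries.simps)
qed

text \<open>
  If \<open>\<iota> \<circ> \<chi> = \<partial>\<psi>\<close>, then \<open>\<pi> \<circ> \<psi>\<close> is a cocycle, and \<open>\<psi>\<close> and \<open>\<chi>\<close> form a zigzag over it.
\<close>
lemma exact_at_A:
  "kernel (HS G A actA (Suc n)) (HS G B actB (Suc n)) (HS_map G B actB (Suc n) \<iota>)
    = connecting n ` carrier (HS G C actC n)"
proof (intro equalityI subsetI)
  fix Y assume Y: "Y \<in> kernel (HS G A actA (Suc n)) (HS G B actB (Suc n)) (HS_map G B actB (Suc n) \<iota>)"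
  then obtain \<chi> where \<chi>: "\<chi> \<in> sym_cocycles G A actA (Suc n)" "Y = sym_class G A actA (Suc n) \<chi>"
    by (auto simp: kernel_def A.carrier_HS)
  then have "push G (Suc n) \<iota> \<chi> \<in> sym_coboundaries G B actB (Suc n)"
    using Y by (simp add: kernel_def \<iota>.HS_map_sym_class B.sym_class_eq_one_iff \<iota>.push_sym_cocycles
        del: sym_coboundaries.simps)
  then obtain \<psi> where \<psi>: "\<psi> \<in> carrier (sym_cochains G B actB n)"
    "push G (Suc n) \<iota> \<chi> = differential G B actB n \<psi>" by auto
  have "differential G C actC n (push G n \<pi> \<psi>) = \<one>\<^bsub>cochains G C (Suc n)\<^esub>"
    using \<pi>.push_differential[OF B.sym_cochains_closed[OF \<psi>(1)]] push_\<pi>_push_\<iota>[OF A.sym_cocycles_closed[OF \<chi>(1)]] \<psi>(2)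
    by simp
  then have z: "zigzag n (push G n \<pi> \<psi>) \<psi> \<chi>"
    using \<psi> \<chi>(1) by (simp add: zigzag_def C.sym_cocycles_iff A.sym_cocycles_iff \<pi>.push_sym_cochains)
  then show "Y \<in> connecting n ` carrier (HS G C actC n)"
    using connecting_zigzag[OF z] \<chi>(2) by (auto simp: C.carrier_HS zigzag_def intro!: image_eqI)
next
  fix Y assume "Y \<in> connecting n ` carrier (HS G C actC n)"
  then obtain \<phi> where \<phi>: "\<phi> \<in> sym_cocycles G C actC n" "Y = connecting n (sym_class G C actC n \<phi>)"
    by (auto simp: C.carrier_HS)
  then obtain \<psi> \<chi> where z: "zigzag n \<phi> \<psi> \<chi>"
    using zigzag_beta by blast
  then have "push G (Suc n) \<iota> \<chi> \<in> sym_coboundaries G B actB (Suc n)"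
    by (simp add: zigzag_def)
  then show "Y \<in> kernel (HS G A actA (Suc n)) (HS G B actB (Suc n)) (HS_map G B actB (Suc n) \<iota>)"
    using \<phi>(2) connecting_zigzag[OF z] zigzag_cocycle[OF z]
    by (simp add: kernel_def A.carrier_HS \<iota>.HS_map_sym_class B.sym_class_eq_one_iff \<iota>.push_sym_cocycles
        del: sym_coboundaries.simps)
qed

lemma is_connecting_hom_connecting: "is_connecting_hom G A actA B actB C actC \<iota> \<pi> n (connecting n)"
  unfolding is_connecting_hom_def
  by (intro conjI ballI allI connecting_hom short_exact_sym_complexes snake_connecting
      exact_at_B exact_at_C exact_at_A)

end

theorem proposition2p3:
  fixes G :: "('g, 'x) monoid_scheme"
    and A :: "('a, 'u) monoid_scheme" and actA :: "'g \<Rightarrow> 'a \<Rightarrow> 'a"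
    and B :: "('b, 'v) monoid_scheme" and actB :: "'g \<Rightarrow> 'b \<Rightarrow> 'b"
    and C :: "('c, 'w) monoid_scheme" and actC :: "'g \<Rightarrow> 'c \<Rightarrow> 'c"
    and \<iota> :: "'a \<Rightarrow> 'b" and \<pi> :: "'b \<Rightarrow> 'c" and s :: "'c \<Rightarrow> 'b" and n :: nat
  assumes finite_G: "group G" "finite (carrier G)"
    and modules: "G_module G A actA" "G_module G B actB" "G_module G C actC"
    and equiv: "equivariant G A actA actB \<iota>" "equivariant G B actB actC \<pi>"
    and exact: "short_exact A B C \<iota> \<pi>"
    and s_closed: "s \<in> carrier C \<rightarrow> carrier B"
    and s_section: "\<And>c. c \<in> carrier C \<Longrightarrow> \<pi> (s c) = c"
    and symmetric: "\<And>c. c \<in> carrier C \<Longrightarrow> s (inv\<^bsub>C\<^esub> c) = inv\<^bsub>B\<^esub> (s c)"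
    and compatible: "\<And>g c. g \<in> carrier G \<Longrightarrow> c \<in> carrier C \<Longrightarrow> s (actC g c) = actB g (s c)"
  shows "\<exists>\<beta>. group_hom (HS G C actC n) (HS G A actA (Suc n)) \<beta>
     \<and> (\<forall>\<phi> \<in> sym_cocycles G C actC n.
          beta_cochain G A B actB \<iota> s n \<phi> \<in> sym_cocycles G A actA (Suc n)
        \<and> \<beta> (sym_class G C actC n \<phi>) = sym_class G A actA (Suc n) (beta_cochain G A B actB \<iota> s n \<phi>))
     \<and> is_connecting_hom G A actA B actB C actC \<iota> \<pi> n \<beta>"
proof -
  have hom: "\<iota> \<in> hom A B" "\<pi> \<in> hom B C"
    using exact by (simp_all add: short_exact_def mon_def epi_def)
  interpret symmetric_extension G A actA B actB C actC \<iota> \<pi> s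
    using modules equiv hom exact s_closed s_section symmetric compatible
    by (intro symmetric_extension.intro symmetric_extension_axioms.intro G_module_hom.intro
        G_module_hom_axioms.intro G_module_odd_map.intro G_module_odd_map_axioms.intro)
      (auto simp: equivariant_def)
  show ?thesis
    using connecting_hom zigzag_beta zigzag_cocycle connecting_zigzag is_connecting_hom_connecting
    by (intro exI[of _ "connecting n"] conjI ballI) blast+
qed

end
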